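(* Let $d, \mathbf{d}, \mathbf{L}, \mathbf{J}, M, K, N \in \mathbb{N}$, $\gamma, L \in \mathbb{R}$, $c \in [\max\{2, L\}, \infty)$, $\mathbf{l} = (\mathbf{l}_0, \ldots, \mathbf{l}_{\mathbf{L}}) \in \mathbb{N}^{\mathbf{L}+1}$, $\mathbf{N} \subseteq \{0, \ldots, N\}$, and assume $0 \in \mathbf{N}$, $\mathbf{l}_0 = d$, $\mathbf{l}_{\mathbf{L}} = 1$, and $\mathbf{d} \geq \sum_{i=1}^{\mathbf{L}} \mathbf{l}_i(\mathbf{l}_{i-1}+1)$. For every $m, n \in \mathbb{N}$, $s \in \mathbb{N}_0$, $\theta = (\theta_1, \ldots, \theta_{\mathbf{d}}) \in \mathbb{R}^{\mathbf{d}}$ with $\mathbf{d} \geq s + mn + m$ let $\mathcal{A}^{\theta,s}_{m,n} \colon \mathbb{R}^n \to \mathbb{R}^m$ be the affine map $\mathcal{A}^{\theta,s}_{m,n}(x) = Wx + \beta$, where $W \in \mathbb{R}^{m \times n}$ has entries $W_{i,j} = \theta_{s+(i-1)n+j}$ and $\beta \in \mathbb{R}^m$ has entries $\beta_i = \theta_{s+mn+i}$. Let $\mathbf{a}_i \colon \mathbb{R}^{\mathbf{l}_i} \to \mathbb{R}^{\mathbf{l}_i}$, $i \in \{1, \ldots, \mathbf{L}\}$, satisfy for all $i \in \mathbb{N} \cap [0, \mathbf{L})$, $x = (x_1, \ldots, x_{\mathbf{l}_i}) \in \mathbb{R}^{\mathbf{l}_i}$ that $\mathbf{a}_i(x) =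 (\max\{x_1, 0\}, \ldots, \max\{x_{\mathbf{l}_i}, 0\})$, and assume for all $x \in \mathbb{R}$ that $\mathbf{a}_{\mathbf{L}}(x) = \max\{\min\{x, 1\}, 0\}$. For every $\theta \in \mathbb{R}^{\mathbf{d}}$ let $\mathcal{N}_\theta \colon \mathbb{R}^d \to \mathbb{R}$ satisfy $$\mathcal{N}_\theta = \mathbf{a}_{\mathbf{L}} \circ \mathcal{A}^{\theta, \sum_{i=1}^{\mathbf{L}-1} \mathbf{l}_i(\mathbf{l}_{i-1}+1)}_{\mathbf{l}_{\mathbf{L}}, \mathbf{l}_{\mathbf{L}-1}} \circ \mathbf{a}_{\mathbf{L}-1} \circ \mathcal{A}^{\theta, \sum_{i=1}^{\mathbf{L}-2} \mathbf{l}_i(\mathbf{l}_{i-1}+1)}_{\mathbf{l}_{\mathbf{L}-1}, \mathbf{l}_{\mathbf{L}-2}} \circ \ldots \circ \mathbf{a}_1 \circ \mathcal{A}^{\theta, 0}_{\mathbf{l}_1, \mathbf{l}_0}.$$ Let $(\Omega, \mathcal{F}, \mathbb{P})$ be a probability space, let $X^{k,n}_j \colon \Omega \to [0,1]^d$, $k, n, j \in \mathbb{N}_0$, and $Y^{k,n}_j \colon \Omega \to [0,1]$, $k, n, j \in \mathbb{N}_0$, be functions, assume that $(X^{0,0}_j, Y^{0,0}_j)$, $j \in \mathbb{N}$, are i.i.d. random variables, let $\mathcal{E} \colon [0,1]^d \to [0,1]$ satisfy $\mathbb{P}$-a.s. that $\mathcal{E}(X^{0,0}_1) = \mathbb{E}[Y^{0,0}_1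 \mid X^{0,0}_1]$, and assume for all $x, y \in [0,1]^d$ that $|\mathcal{E}(x) - \mathcal{E}(y)| \leq L \|x - y\|_1$. Let $\Theta_{k,n} \colon \Omega \to \mathbb{R}^{\mathbf{d}}$, $k, n \in \mathbb{N}_0$, and $\mathbf{k} \colon \Omega \to (\mathbb{N}_0)^2$ be random variables, assume $\bigl(\bigcup_{k=1}^\infty \Theta_{k,0}(\Omega)\bigr) \subseteq [-c, c]^{\mathbf{d}}$, assume that $\Theta_{k,0}$, $k \in \mathbb{N}$, are i.i.d., and assume that $\Theta_{1,0}$ is continuous uniformly distributed on $[-c, c]^{\mathbf{d}}$. Let $\mathcal{R}^{k,n}_J \colon \mathbb{R}^{\mathbf{d}} \times \Omega \to [0, \infty)$, $k, n, J \in \mathbb{N}_0$, and $\mathcal{G}^{k,n} \colon \mathbb{R}^{\mathbf{d}} \times \Omega \to \mathbb{R}^{\mathbf{d}}$, $k, n \in \mathbb{N}$, satisfy for all $k, n \in \mathbb{N}$, $\omega \in \Omega$ and all $\theta \in \mathbb{R}^{\mathbf{d}}$ at which the function $\mathcal{R}^{k,n}_{\mathbf{J}}(\cdot, \omega) \colon \mathbb{R}^{\mathbf{d}} \to [0,\infty)$ is differentiable that $\mathcal{G}^{k,n}(\theta, \omega) = (\nabla_\theta \mathcal{R}^{k,n}_{\mathbf{J}})(\theta, \omega)$. Assume for all $k, n \in \mathbb{N}$ that $\Theta_{k,n} = \Theta_{k,n-1} - \gamma\, \mathcal{G}^{k,n}(\Theta_{k,n-1})$, and assume for all $k, n \in \mathbb{N}_0$,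 $J \in \mathbb{N}$, $\theta \in \mathbb{R}^{\mathbf{d}}$, $\omega \in \Omega$ that $$\mathcal{R}^{k,n}_J(\theta, \omega) = \frac{1}{J} \biggl[ \sum_{j=1}^J |\mathcal{N}_\theta(X^{k,n}_j(\omega)) - Y^{k,n}_j(\omega)|^2 \biggr]$$ and $$\mathbf{k}(\omega) \in \operatorname{arg\,min}_{(l,m) \in \{1, \ldots, K\} \times \mathbf{N},\ \|\Theta_{l,m}(\omega)\|_\infty \leq c} \mathcal{R}^{0,0}_M(\Theta_{l,m}(\omega), \omega).$$ Then $$\mathbb{E}\Bigl[ \int_{[0,1]^d} |\mathcal{N}_{\Theta_{\mathbf{k}}}(x) - \mathcal{E}(x)| \, \mathbb{P}_{X^{0,0}_1}(\mathrm{d}x) \Bigr] \leq \frac{d c^3}{[\min\{\mathbf{L}, \mathbf{l}_1, \ldots, \mathbf{l}_{\mathbf{L}-1}\}]^{1/d}} + \frac{c^3 \mathbf{L} (\|\mathbf{l}\|_\infty + 1) \ln(eM)}{M^{1/4}} + \frac{\mathbf{L} (\|\mathbf{l}\|_\infty + 1)^{\mathbf{L}} c^{\mathbf{L}+1}}{K^{[(2\mathbf{L})^{-1} (\|\mathbf{l}\|_\infty + 1)^{-2}]}}.$$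
   Context: $\mathbb{N} = \{1,2,\ldots\}$, $\mathbb{N}_0 = \{0,1,2,\ldots\}$. For a vector $x = (x_1,\dots,x_n) \in \mathbb{R}^n$, $\|x\|_p = (\sum_i |x_i|^p)^{1/p}$ for $p \in [1,\infty)$ and $\|x\|_\infty = \max_i |x_i|$. $\mathbb{P}_X$ denotes the law of a random variable $X$. The argument $\omega$ is suppressed in the usual way: $\mathcal{G}^{k,n}(\Theta_{k,n-1})$ denotes $\omega \mapsto \mathcal{G}^{k,n}(\Theta_{k,n-1}(\omega),\omega)$, and $\Theta_{\mathbf{k}}$ denotes $\omega \mapsto \Theta_{\mathbf{k}(\omega)}(\omega)$, where $\Theta_{\mathbf{k}(\omega)} = \Theta_{k,n}$ if $\mathbf{k}(\omega) = (k,n)$. The arg min denotes the set of minimisers over the indicated (finite) index set. Empty sums are $0$; for $\mathbf{L} = 1$ one has $\mathcal{N}_\theta = \mathbf{a}_1 \circ \mathcal{A}^{\theta,0}_{\mathbf{l}_1,\mathbf{l}_0}$ and $\min\{\mathbf{L}, \mathbf{l}_1, \ldots, \mathbf{l}_{\mathbf{L}-1}\} = \mathbf{L}$. *)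

theory Defs
  imports "HOL-Probability.Probability"
begin

text \<open>
  The layer widths of a network are data of the theorem, so the vectors passed between layers are
  functions \<^typ>\<open>nat \<Rightarrow> real\<close>: the space of real \<open>n\<close>-tuples is \<^term>\<open>tuples n\<close>, with coordinates
  indexed by \<open>1, \<dots>, n\<close> and the value \<^term>\<open>undefined\<close> at all other indices.
\<close>

abbreviation tuples :: "nat \<Rightarrow> (nat \<Rightarrow> real) set" where
  "tuples n \<equiv> {1..n} \<rightarrow>\<^sub>E UNIV"

text \<open>
  The network inputs and the parameter vectors live in the Euclidean spaces \<^typ>\<open>real ^ 'n\<close>, where
  measures and derivatives are available. A bijection \<open>\<iota>\<close> from \<open>{1..n}\<close> onto the index
  type \<open>'n\<close> says which coordinate is the \<open>i\<close>-th one.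
\<close>

definition to_tuple :: "nat \<Rightarrow> (nat \<Rightarrow> 'n) \<Rightarrow> real ^ 'n \<Rightarrow> nat \<Rightarrow> real" where
  "to_tuple n \<iota> x = (\<lambda>i\<in>{1..n}. x $ \<iota> i)"

text \<open>
  Starting after position \<open>s\<close>, the parameter vector lists the \<open>m \<times> n\<close> weight matrix row by row and
  then the \<open>m\<close> biases.
\<close>

definition affine_layer :: "(nat \<Rightarrow> real) \<Rightarrow> nat \<Rightarrow> nat \<Rightarrow> nat \<Rightarrow> (nat \<Rightarrow> real) \<Rightarrow> nat \<Rightarrow> real" where
  "affine_layer \<theta> s m n x =
     (\<lambda>i\<in>{1..m}. (\<Sum>j=1..n. \<theta> (s + (i - 1) * n + j) * x j) + \<theta> (s + m * n + i))"

definition param_count :: "(nat \<Rightarrow> nat) \<Rightarrow> nat \<Rightarrow> nat" where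
  "param_count l i = (\<Sum>k=1..i. l k * (l (k - 1) + 1))"

primrec network :: "(nat \<Rightarrow> (nat \<Rightarrow> real) \<Rightarrow> nat \<Rightarrow> real) \<Rightarrow> (nat \<Rightarrow> nat) \<Rightarrow> (nat \<Rightarrow> real) \<Rightarrow>
    nat \<Rightarrow> (nat \<Rightarrow> real) \<Rightarrow> nat \<Rightarrow> real" where
  "network a l \<theta> 0 x = x"
| "network a l \<theta> (Suc i) x =
     a (Suc i) (affine_layer \<theta> (param_count l i) (l (Suc i)) (l i) (network a l \<theta> i x))"

definition unit_cube :: "(real ^ 'n) set" where
  "unit_cube = cbox (\<chi> i. 0) (\<chi> i. 1)"

definition norm1 :: "real ^ 'n \<Rightarrow> real" where
  "norm1 x = (\<Sum>i\<in>UNIV. \<bar>x $ i\<bar>)"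

text \<open>Measurability of every \<open>Z i\<close> is part of \<open>indep_vars\<close>.\<close>

definition iid :: "'w measure \<Rightarrow> ('i \<Rightarrow> 'w \<Rightarrow> 'b::topological_space) \<Rightarrow> 'i set \<Rightarrow> bool" where
  "iid P Z I \<longleftrightarrow> prob_space.indep_vars P (\<lambda>_. borel) Z I \<and>
     (\<forall>i\<in>I. \<forall>j\<in>I. distr P borel (Z i) = distr P borel (Z j))"

definition cond_exp_given :: "'w measure \<Rightarrow> ('w \<Rightarrow> real) \<Rightarrow> ('w \<Rightarrow> 'b::topological_space) \<Rightarrow> 'w \<Rightarrow> real" where
  "cond_exp_given P Y X = real_cond_exp P (vimage_algebra (space P) X borel) Y"

end

theory Submission
  imports Defs
begin

text \<open>
  The root mean square distance of the selected network to the regression function is at most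
  \<open>sqrt (T1\<^sup>2 + T2\<^sup>2 + T3\<^sup>2) \<le> T1 + T2 + T3\<close> by the bias-variance decomposition, and each \<open>T\<close> has its own
  source. Approximation (\<open>T1\<close>): the maximum of the cones \<open>y - L * norm1 (x - p)\<close> over a grid of points
  \<open>p\<close> is computed exactly by a network that handles one grid point per layer. Generalization (\<open>T2\<close>):
  the realization is Lipschitz in its parameters, so a union bound over a grid of \<open>M ^ LL\<close> values per
  active parameter and Hoeffding's lemma control the empirical risk uniformly. Optimization (\<open>T3\<close>):
  the gradient steps are irrelevant, because \<open>0 \<in> NN\<close> lets the selection fall back on the \<open>K\<close>
  independent initializations, one of which is probably close to the approximating parameter vector.
  Since the left-hand side is at most \<open>1\<close>, only \<open>T1 < 1\<close> and \<open>T2 < 1\<close> need work; these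
  inequalities absorb all constants and logarithms.
\<close>

section \<open>Realizations of clipped networks\<close>

text \<open>The obstacle is that the selected parameter depends on the sample and on gradient
  iterates about which nothing is known. Hence the deviation is dominated by one integrable
  \<open>S\<close> that is valid for all parameters in the cube at once, and errors are compared
  pointwise in \<open>\<omega>\<close> before anything is integrated. The price of uniformity is the
  logarithm of the size of the net, of order \<open>LL * D * ln M\<close>, where \<open>D\<close> is
  the number of active parameters. With \<open>W\<close> the maximal width plus 1, the exponents
  \<open>1 / 4\<close> and \<open>1 / (2 * LL * W\<^sup>2)\<close> are half of the natural ones: the
  square loss controls the squared distance, where deviations have order
  \<open>M powr (- 1 / 2)\<close> up to logarithms, and the initializations give
  \<open>K powr (- 1 / (LL * W\<^sup>2))\<close>. The latter comes from a balance: hitting a box of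
  relative side length \<open>\<tau>\<close> fails with probability at most
  \<open>1 / (K * \<tau> ^ D)\<close>, while the distance costs a multiple of \<open>\<tau>\<close>.
  Both agree for \<open>\<tau> = K powr (- 1 / (D + 1))\<close>, and \<open>D + 1\<close> is at most
  \<open>LL * W\<^sup>2\<close>.\<close>

lemma param_count_Suc: "param_count l (Suc i) = param_count l i + l (Suc i) * (l i + 1)"
  by (simp add: param_count_def)

lemma param_count_mono: "i \<le> k \<Longrightarrow> param_count l i \<le> param_count l k"
  unfolding param_count_def by (rule sum_mono2) auto

lemma weight_index_le:
  fixes i j m n :: nat
  assumes "i \<in> {1..m}" "j \<in> {1..n}"
  shows "(i - 1) * n + j \<in> {1..m * n}"
proof -
  have "(i - 1) * n + j \<le> (i - 1) * n + n" using assms by simp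
  also have "\<dots> = i * n" using assms by (cases i) auto
  also have "\<dots> \<le> m * n" using assms by simp
  finally show ?thesis using assms by simp
qed

locale clipped_relu_network =
  fixes LL :: nat and l :: "nat \<Rightarrow> nat" and a :: "nat \<Rightarrow> (nat \<Rightarrow> real) \<Rightarrow> nat \<Rightarrow> real"
  assumes LL_pos: "LL \<ge> 1" and l_pos: "\<And>i. i \<le> LL \<Longrightarrow> l i \<ge> 1" and l_LL: "l LL = 1"
    and relu: "\<And>i x. 1 \<le> i \<Longrightarrow> i < LL \<Longrightarrow> x \<in> tuples (l i) \<Longrightarrow> a i x = (\<lambda>j\<in>{1..l i}. max (x j) 0)"
    and clip: "\<And>x. x \<in> tuples 1 \<Longrightarrow> a LL x = (\<lambda>j\<in>{1..1}. max (min (x j) 1) 0)"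
begin

text \<open>The index is grouped as offset of the layer's block plus position inside the block, the
  grouping used by \<open>index_bounds\<close> and \<open>parameters_of_weights\<close>.\<close>

definition preact :: "(nat \<Rightarrow> real) \<Rightarrow> nat \<Rightarrow> (nat \<Rightarrow> real) \<Rightarrow> nat \<Rightarrow> real" where
  "preact \<theta> i x j =
     (\<Sum>k=1..l i. \<theta> (param_count l i + ((j - 1) * l i + k)) * network a l \<theta> i x k)
       + \<theta> (param_count l i + (l (Suc i) * l i + j))"

definition act :: "nat \<Rightarrow> real \<Rightarrow> real" where
  "act i z = (if i = LL then max (min z 1) 0 else max z 0)"

text \<open>The maps \<open>a i\<close> are specified only on tuples of the right length. Every
  output of \<open>affine_layer\<close> is such a tuple, so the scalar \<open>act\<close> can
  replace them with no condition on \<open>x\<close>.\<close>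

lemma network_step:
  assumes "i < LL" "j \<in> {1..l (Suc i)}"
  shows "network a l \<theta> (Suc i) x j = act (Suc i) (preact \<theta> i x j)"
proof -
  let ?y = "affine_layer \<theta> (param_count l i) (l (Suc i)) (l i) (network a l \<theta> i x)"
  have y: "?y \<in> tuples (l (Suc i))" by (auto simp: affine_layer_def)
  have yj: "?y j = preact \<theta> i x j"
    using assms by (simp add: affine_layer_def preact_def add.assoc)
  show ?thesis
  proof (cases "Suc i = LL")
    case True
    have j: "j = 1" and n: "l (Suc i) = 1" using assms True l_LL by auto
    have "network a l \<theta> (Suc i) x j = a LL ?y 1" unfolding True[symmetric] j by simp
    also have "\<dots> = max (min (preact \<theta> i x j) 1) 0"
      using clip[of ?y] y yj unfolding n j by simp
    finally show ?thesis unfolding act_def using True by simp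
  next
    case False
    then show ?thesis using relu[of "Suc i" ?y] y yj assms by (simp add: act_def)
  qed
qed

lemma act_lipschitz: "\<bar>act i z - act i z'\<bar> \<le> \<bar>z - z'\<bar>"
  by (auto simp: act_def)

lemma abs_act_le: "\<bar>act i z\<bar> \<le> \<bar>z\<bar>"
  by (auto simp: act_def)

lemma continuous_act: "continuous_on UNIV f \<Longrightarrow> continuous_on UNIV (\<lambda>z. act i (f z))"
  unfolding act_def by (cases "i = LL") (auto intro!: continuous_intros)

lemma network_output_range: "network a l \<theta> LL x 1 \<in> {0..1}"
proof -
  obtain i where "LL = Suc i" using LL_pos by (cases LL) auto
  then have "network a l \<theta> LL x 1 = act LL (preact \<theta> i x 1)"
    using network_step[of i 1 \<theta> x] l_LL by simp
  then show ?thesis unfolding act_def by simp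
qed

lemma index_bounds:
  assumes "i < LL" "j \<in> {1..l (Suc i)}"
  shows "k \<in> {1..l i} \<Longrightarrow> param_count l i + ((j - 1) * l i + k) \<in> {1..param_count l LL}"
    and "param_count l i + (l (Suc i) * l i + j) \<in> {1..param_count l LL}"
proof -
  have le: "param_count l i + l (Suc i) * (l i + 1) \<le> param_count l LL"
    using param_count_mono[of "Suc i" LL l] assms by (simp add: param_count_Suc)
  show "param_count l i + (l (Suc i) * l i + j) \<in> {1..param_count l LL}"
    using le assms by (auto simp: algebra_simps)
  show "param_count l i + ((j - 1) * l i + k) \<in> {1..param_count l LL}" if k: "k \<in> {1..l i}"
    using weight_index_le[OF assms(2) k] le by auto
qed

text \<open>A preactivation adds \<open>l i\<close> products and one bias, each at most
  \<open>c\<close> times the previous bound, which is at least 1 because \<open>c * W\<close> is. So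
  a layer costs a factor \<open>c * W\<close>.\<close>

lemma network_bound:
  assumes c: "c \<ge> 1" and W: "\<And>i. i \<le> LL \<Longrightarrow> real (l i) + 1 \<le> W"
    and \<theta>: "\<And>k. k \<in> {1..param_count l LL} \<Longrightarrow> \<bar>\<theta> k\<bar> \<le> c"
    and x: "\<And>j. j \<in> {1..l 0} \<Longrightarrow> \<bar>x j\<bar> \<le> 1"
  shows "i \<le> LL \<Longrightarrow> j \<in> {1..l i} \<Longrightarrow> \<bar>network a l \<theta> i x j\<bar> \<le> (c * W) ^ i"
proof (induction i arbitrary: j)
  case 0
  then show ?case using x by simp
next
  case (Suc i)
  have i: "i < LL" using Suc.prems by simp
  have W0: "W \<ge> 1" using W[of 0] by simp
  have cW: "c * W \<ge> 1" using c W0 mult_mono[of 1 c 1 W] by simp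
  have pow: "(c * W) ^ i \<ge> 1" using cW by (rule one_le_power)
  have "\<bar>network a l \<theta> (Suc i) x j\<bar> \<le> \<bar>preact \<theta> i x j\<bar>"
    using network_step[OF i Suc.prems(2)] abs_act_le by simp
  also have "\<dots> \<le> (\<Sum>k=1..l i. c * (c * W) ^ i) + c"
    unfolding preact_def
  proof (intro order_trans[OF abs_triangle_ineq] add_mono order_trans[OF sum_abs] sum_mono)
    fix k assume k: "k \<in> {1..l i}"
    have "\<bar>\<theta> (param_count l i + ((j - 1) * l i + k)) * network a l \<theta> i x k\<bar>
        = \<bar>\<theta> (param_count l i + ((j - 1) * l i + k))\<bar> * \<bar>network a l \<theta> i x k\<bar>"
      by (rule abs_mult)
    also have "\<dots> \<le> c * (c * W) ^ i"
      using \<theta>[OF index_bounds(1)[OF i Suc.prems(2) k]] Suc.IH[OF _ k] i c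
      by (intro mult_mono) auto
    finally show "\<bar>\<theta> (param_count l i + ((j - 1) * l i + k)) * network a l \<theta> i x k\<bar>
      \<le> c * (c * W) ^ i" .
  next
    show "\<bar>\<theta> (param_count l i + (l (Suc i) * l i + j))\<bar> \<le> c"
      using \<theta>[OF index_bounds(2)[OF i Suc.prems(2)]] .
  qed
  also have "\<dots> \<le> real (l i) * (c * (c * W) ^ i) + c * (c * W) ^ i"
    using pow c by simp
  also have "\<dots> = (real (l i) + 1) * (c * (c * W) ^ i)" by (simp add: algebra_simps)
  also have "\<dots> \<le> W * (c * (c * W) ^ i)"
    using W[of i] i c pow by (intro mult_right_mono) auto
  finally show ?case by (simp add: algebra_simps)
qed

text \<open>Changing the parameters of one layer costs \<open>\<epsilon>\<close> times the size
  \<open>(c * W) ^ i\<close> of its inputs, and every later layer amplifies a difference by at most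
  \<open>c * W\<close>. All layers thus contribute equally, whence the linear factor
  \<open>i\<close>. The \<open>c\<close> on the left keeps the induction free of division.\<close>

lemma network_lipschitz:
  assumes c: "c \<ge> 1" and W: "\<And>i. i \<le> LL \<Longrightarrow> real (l i) + 1 \<le> W"
    and \<theta>: "\<And>k. k \<in> {1..param_count l LL} \<Longrightarrow> \<bar>\<theta> k\<bar> \<le> c"
    and \<eta>: "\<And>k. k \<in> {1..param_count l LL} \<Longrightarrow> \<bar>\<eta> k\<bar> \<le> c"
    and close: "\<And>k. k \<in> {1..param_count l LL} \<Longrightarrow> \<bar>\<theta> k - \<eta> k\<bar> \<le> \<epsilon>"
    and x: "\<And>j. j \<in> {1..l 0} \<Longrightarrow> \<bar>x j\<bar> \<le> 1"
  shows "i \<le> LL \<Longrightarrow> j \<in> {1..l i} \<Longrightarrow>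
    c * \<bar>network a l \<theta> i x j - network a l \<eta> i x j\<bar> \<le> \<epsilon> * real i * (c * W) ^ i"
proof (induction i arbitrary: j)
  case 0
  then show ?case by simp
next
  case (Suc i)
  have i: "i < LL" using Suc.prems by simp
  have W0: "W \<ge> 1" using W[of 0] by simp
  have cW: "c * W \<ge> 1" using c W0 mult_mono[of 1 c 1 W] by simp
  have pow: "(c * W) ^ i \<ge> 1" using cW by (rule one_le_power)
  have \<epsilon>: "\<epsilon> \<ge> 0"
    using close[OF index_bounds(2)[OF i Suc.prems(2)]] by (meson abs_ge_zero order_trans)
  let ?D = "\<epsilon> * real i * (c * W) ^ i + \<epsilon> * (c * W) ^ i"
  let ?w = "\<lambda>\<theta> k. \<theta> (param_count l i + ((j - 1) * l i + k)) :: real"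
  let ?b = "\<lambda>\<theta>. \<theta> (param_count l i + (l (Suc i) * l i + j)) :: real"
  let ?h = "\<lambda>\<theta> k. network a l \<theta> i x k"
  have "\<bar>network a l \<theta> (Suc i) x j - network a l \<eta> (Suc i) x j\<bar>
      \<le> \<bar>preact \<theta> i x j - preact \<eta> i x j\<bar>"
    using network_step[OF i Suc.prems(2)] act_lipschitz by simp
  moreover have "preact \<theta> i x j - preact \<eta> i x j
      = (\<Sum>k=1..l i. ?w \<theta> k * ?h \<theta> k - ?w \<eta> k * ?h \<eta> k) + (?b \<theta> - ?b \<eta>)"
    unfolding preact_def by (simp add: sum_subtractf)
  moreover have "\<bar>(\<Sum>k=1..l i. ?w \<theta> k * ?h \<theta> k - ?w \<eta> k * ?h \<eta> k) + (?b \<theta> - ?b \<eta>)\<bar>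
      \<le> (\<Sum>k=1..l i. ?D) + \<epsilon>"
  proof (intro order_trans[OF abs_triangle_ineq] add_mono order_trans[OF sum_abs] sum_mono)
    fix k assume k: "k \<in> {1..l i}"
    have split: "?w \<theta> k * ?h \<theta> k - ?w \<eta> k * ?h \<eta> k
        = ?w \<theta> k * (?h \<theta> k - ?h \<eta> k) + (?w \<theta> k - ?w \<eta> k) * ?h \<eta> k"
      by (simp add: algebra_simps)
    have "\<bar>?w \<theta> k * ?h \<theta> k - ?w \<eta> k * ?h \<eta> k\<bar>
        \<le> \<bar>?w \<theta> k\<bar> * \<bar>?h \<theta> k - ?h \<eta> k\<bar> + \<bar>?w \<theta> k - ?w \<eta> k\<bar> * \<bar>?h \<eta> k\<bar>"
      unfolding split by (rule order_trans[OF abs_triangle_ineq]) (simp add: abs_mult)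
    also have "\<dots> \<le> c * \<bar>?h \<theta> k - ?h \<eta> k\<bar> + \<epsilon> * (c * W) ^ i"
    proof (rule add_mono)
      note q = index_bounds(1)[OF i Suc.prems(2) k]
      show "\<bar>?w \<theta> k\<bar> * \<bar>?h \<theta> k - ?h \<eta> k\<bar> \<le> c * \<bar>?h \<theta> k - ?h \<eta> k\<bar>"
        by (rule mult_right_mono[OF \<theta>[OF q] abs_ge_zero])
      have "\<bar>?h \<eta> k\<bar> \<le> (c * W) ^ i"
      proof (rule network_bound)
        show "\<And>i. i \<le> LL \<Longrightarrow> real (l i) + 1 \<le> W" by (rule W)
        show "\<And>k. k \<in> {1..param_count l LL} \<Longrightarrow> \<bar>\<eta> k\<bar> \<le> c" by (rule \<eta>)
        show "\<And>j. j \<in> {1..l 0} \<Longrightarrow> \<bar>x j\<bar> \<le> 1" by (rule x)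
      qed (use c i k in auto)
      then show "\<bar>?w \<theta> k - ?w \<eta> k\<bar> * \<bar>?h \<eta> k\<bar> \<le> \<epsilon> * (c * W) ^ i"
        by (rule mult_mono[OF close[OF q] _ \<epsilon> abs_ge_zero])
    qed
    also have "\<dots> \<le> ?D"
      by (rule add_right_mono[OF Suc.IH[OF less_imp_le[OF i] k]])
    finally show "\<bar>?w \<theta> k * ?h \<theta> k - ?w \<eta> k * ?h \<eta> k\<bar> \<le> ?D" .
  next
    show "\<bar>?b \<theta> - ?b \<eta>\<bar> \<le> \<epsilon>"
      using close[OF index_bounds(2)[OF i Suc.prems(2)]] .
  qed
  ultimately have "\<bar>network a l \<theta> (Suc i) x j - network a l \<eta> (Suc i) x j\<bar>
      \<le> (\<Sum>k=1..l i. ?D) + \<epsilon>"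
    by simp
  also have "\<dots> \<le> real (l i) * ?D + ?D"
  proof -
    have "\<epsilon> \<le> \<epsilon> * (c * W) ^ i" using pow \<epsilon> mult_left_mono[of 1 "(c * W) ^ i" \<epsilon>] by simp
    moreover have "0 \<le> \<epsilon> * real i * (c * W) ^ i" using \<epsilon> pow by simp
    ultimately have "\<epsilon> \<le> ?D" by linarith
    then show ?thesis by simp
  qed
  also have "\<dots> = (real (l i) + 1) * ?D" by (simp add: algebra_simps)
  also have "\<dots> \<le> W * ?D"
    using W[of i] i \<epsilon> pow by (intro mult_right_mono) auto
  finally have "c * \<bar>network a l \<theta> (Suc i) x j - network a l \<eta> (Suc i) x j\<bar> \<le> c * (W * ?D)"
    using c by (intro mult_left_mono) auto
  then show ?case by (simp add: algebra_simps)
qed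

lemma continuous_network:
  fixes \<Phi> :: "'z::topological_space \<Rightarrow> nat \<Rightarrow> real"
  assumes "\<And>k. continuous_on UNIV (\<lambda>z. \<Phi> z k)" "\<And>k. continuous_on UNIV (\<lambda>z. \<xi> z k)"
  shows "i \<le> LL \<Longrightarrow> j \<in> {1..l i} \<Longrightarrow> continuous_on UNIV (\<lambda>z. network a l (\<Phi> z) i (\<xi> z) j)"
proof (induction i arbitrary: j)
  case 0
  then show ?case using assms by simp
next
  case (Suc i)
  have "continuous_on UNIV (\<lambda>z. act (Suc i) (preact (\<Phi> z) i (\<xi> z) j))"
    unfolding preact_def using Suc
    by (intro continuous_act continuous_intros assms) auto
  then show ?case using network_step[of i j] Suc.prems by simp
qed

end

text \<open>Lets a network be designed through its matrices and biases. The layers occupy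
  consecutive disjoint blocks, so the induction appends one block behind position
  \<open>param_count l n\<close> and leaves the earlier ones untouched.\<close>

lemma parameters_of_weights:
  fixes w :: "nat \<Rightarrow> nat \<Rightarrow> nat \<Rightarrow> real"
  assumes "\<And>i j k. \<bar>w i j k\<bar> \<le> c" "\<And>i j. \<bar>b i j\<bar> \<le> c"
  shows "\<exists>\<theta>. (\<forall>q. \<bar>\<theta> q\<bar> \<le> c) \<and> (\<forall>i<n. \<forall>j\<in>{1..l (Suc i)}.
      (\<forall>k\<in>{1..l i}. \<theta> (param_count l i + ((j - 1) * l i + k)) = w i j k) \<and>
      \<theta> (param_count l i + (l (Suc i) * l i + j)) = b i j)"
proof (induction n)
  case 0
  have "c \<ge> 0" using order_trans[OF abs_ge_zero assms(1)] .
  then show ?case by (intro exI[of _ "\<lambda>_. 0"]) auto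
next
  case (Suc n)
  then obtain \<theta> where \<theta>: "\<And>q. \<bar>\<theta> q\<bar> \<le> c"
    "\<And>i j k. i < n \<Longrightarrow> j \<in> {1..l (Suc i)} \<Longrightarrow> k \<in> {1..l i} \<Longrightarrow>
       \<theta> (param_count l i + ((j - 1) * l i + k)) = w i j k"
    "\<And>i j. i < n \<Longrightarrow> j \<in> {1..l (Suc i)} \<Longrightarrow> \<theta> (param_count l i + (l (Suc i) * l i + j)) = b i j"
    by blast
  let ?s = "param_count l n" and ?mn = "l (Suc n) * l n"
  \<comment> \<open>Positions in the new block count from 1: after subtracting 1, quotient and
    remainder by \<open>l n\<close> recover row and column of the row-major order.\<close>
  define \<eta> where "\<eta> q = (if q \<le> ?s then \<theta> q
     else if q - ?s \<le> ?mn then w n ((q - ?s - 1) div l n + 1) ((q - ?s - 1) mod l n + 1)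
     else b n (q - ?s - ?mn))" for q
  have "\<eta> (param_count l i + ((j - 1) * l i + k)) = w i j k"
    if "i < Suc n" "j \<in> {1..l (Suc i)}" "k \<in> {1..l i}" for i j k
  proof (cases "i = n")
    case True
    have "(j - 1) * l n + k \<in> {1..?mn}" using weight_index_le that True by blast
    moreover have "(j - 1) * l n + k - 1 = (k - 1) + (j - 1) * l n" using that by simp
    moreover have "(k - 1) < l n" using that True by auto
    ultimately have "((j - 1) * l n + k - 1) div l n + 1 = j" "((j - 1) * l n + k - 1) mod l n + 1 = k"
      using that by (simp_all only: div_mult_self1 mod_mult_self1 div_less mod_less) auto
    then show ?thesis using True \<open>(j - 1) * l n + k \<in> {1..?mn}\<close> by (simp add: \<eta>_def)
  next
    case False
    then have "i < n" using that by simp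
    then have "param_count l (Suc i) \<le> ?s" by (intro param_count_mono) simp
    then have "param_count l i + ((j - 1) * l i + k) \<le> ?s"
      using weight_index_le[OF that(2,3)] by (simp add: param_count_Suc)
    then show ?thesis using \<theta>(2)[OF \<open>i < n\<close> that(2,3)] by (simp add: \<eta>_def)
  qed
  moreover have "\<eta> (param_count l i + (l (Suc i) * l i + j)) = b i j"
    if "i < Suc n" "j \<in> {1..l (Suc i)}" for i j
  proof (cases "i = n")
    case True
    then show ?thesis using that by (simp add: \<eta>_def)
  next
    case False
    then have "i < n" using that by simp
    then have "param_count l (Suc i) \<le> ?s" by (intro param_count_mono) simp
    then have "param_count l i + (l (Suc i) * l i + j) \<le> ?s"
      using that by (simp add: param_count_Suc)
    then show ?thesis using \<theta>(3)[OF \<open>i < n\<close> that(2)] by (simp add: \<eta>_def)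
  qed
  moreover have "\<bar>\<eta> q\<bar> \<le> c" for q using \<theta>(1) assms by (simp add: \<eta>_def)
  ultimately show ?case by blast
qed

section \<open>Approximation\<close>

lemma sum_atLeast1_add:
  fixes f :: "nat \<Rightarrow> real"
  shows "(\<Sum>k=1..m+n. f k) = (\<Sum>k=1..m. f k) + (\<Sum>k=1..n. f (m + k))"
  by (induction n) (simp_all add: add.assoc)

text \<open>Follows the layout of a layer of the cone network: three blocks of \<open>d\<close>
  neurons, two accumulators, and surplus neurons that are never read.\<close>

lemma sum_three_blocks:
  fixes f :: "nat \<Rightarrow> real"
  assumes "\<And>k. 3 * d + 2 < k \<Longrightarrow> f k = 0" "3 * d + 2 \<le> m"
  shows "(\<Sum>k=1..m. f k)
    = (\<Sum>k=1..d. f k + f (d + k) + f (2 * d + k)) + f (3 * d + 1) + f (3 * d + 2)"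
proof -
  have "(\<Sum>k=1..m. f k) = (\<Sum>k=1..d+d+d+2. f k)"
    using assms by (intro sum.mono_neutral_right) auto
  also have "\<dots> = (\<Sum>k=1..d. f k + f (d + k) + f (2 * d + k)) + f (3 * d + 1) + f (3 * d + 2)"
    unfolding sum_atLeast1_add sum.distrib
    by (simp add: numeral_2_eq_2 numeral_3_eq_3 add.assoc)
  finally show ?thesis .
qed

text \<open>The lower McShane extension of the values \<open>y s\<close> at the points
  \<open>p s\<close>, cut off from below at 0. The recursion mirrors the depth of the network, one
  more cone per layer.\<close>

primrec cone_max :: "nat \<Rightarrow> (nat \<Rightarrow> nat \<Rightarrow> real) \<Rightarrow> (nat \<Rightarrow> real) \<Rightarrow> real \<Rightarrow> (nat \<Rightarrow> real) \<Rightarrow> nat \<Rightarrow> real" where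
  "cone_max d p y \<Lambda> x 0 = 0"
| "cone_max d p y \<Lambda> x (Suc t) =
     max (cone_max d p y \<Lambda> x t) (y (Suc t) - \<Lambda> * (\<Sum>i=1..d. \<bar>x i - p (Suc t) i\<bar>))"

lemma cone_max_nonneg: "cone_max d p y \<Lambda> x t \<ge> 0"
  by (induction t) auto

lemma cone_max_le:
  assumes "B \<ge> 0" "\<And>s. s \<in> {1..t} \<Longrightarrow> y s - \<Lambda> * (\<Sum>i=1..d. \<bar>x i - p s i\<bar>) \<le> B"
  shows "cone_max d p y \<Lambda> x t \<le> B"
  using assms by (induction t) auto

lemma cone_max_ge:
  assumes "s \<in> {1..t}"
  shows "y s - \<Lambda> * (\<Sum>i=1..d. \<bar>x i - p s i\<bar>) \<le> cone_max d p y \<Lambda> x t"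
  using assms by (induction t) (auto simp: le_Suc_eq)

lemma abs_if_le: "(Q \<Longrightarrow> \<bar>u\<bar> \<le> c) \<Longrightarrow> (\<not> Q \<Longrightarrow> \<bar>v\<bar> \<le> c) \<Longrightarrow> \<bar>if Q then u else v\<bar> \<le> (c::real)"
  by simp

context clipped_relu_network
begin

text \<open>
  Layer \<open>t\<close> carries the input in the neurons \<open>1, \<dots>, d\<close>, the positive and negative parts of \<open>x - p t\<close>
  in the next \<open>2 d\<close> neurons, and two nonnegative numbers with sum \<open>cone_max d p y \<Lambda> x (t - 1)\<close> in the
  neurons \<open>3 d + 1\<close> and \<open>3 d + 2\<close>: since \<open>max r s = r + max (s - r) 0\<close>, one layer per cone suffices.
\<close>

lemma network_cone_max:
  assumes LL: "LL \<ge> 2" and l0: "l 0 = d" and wide: "\<And>i. 1 \<le> i \<Longrightarrow> i < LL \<Longrightarrow> l i \<ge> 3 * d + 2"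
    and c: "c \<ge> 1" and \<Lambda>: "0 \<le> \<Lambda>" "\<Lambda> \<le> c"
    and p: "\<And>t i. \<bar>p t i\<bar> \<le> c" and y: "\<And>t. \<bar>y t\<bar> \<le> c" and y0: "y 0 = 0"
  shows "\<exists>\<theta>. (\<forall>q. \<bar>\<theta> q\<bar> \<le> c) \<and> (\<forall>x. (\<forall>i\<in>{1..d}. x i \<ge> 0) \<longrightarrow>
    network a l \<theta> LL x 1 = min (cone_max d p y \<Lambda> x (LL - 2)) 1)"
proof -
  \<comment> \<open>The last branch is the row of neuron \<open>3 * d + 2\<close>: it subtracts
    \<open>\<Lambda>\<close> times both blocks of parts, whose sum is the distance to the current
    point, and both accumulators. Columns beyond \<open>3 * d + 2\<close> have weight 0 in every
    row, so surplus neurons have no effect.\<close>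
  define w where "w i j k = (if i = LL - 1 then (if k = 3 * d + 1 \<or> k = 3 * d + 2 then 1 else 0)
      else if j \<le> d then (if k = j then 1 else 0)
      else if j \<le> 2 * d then (if k = j - d then 1 else 0)
      else if j \<le> 3 * d then (if k = j - 2 * d then - 1 else 0)
      else if j = 3 * d + 1 then (if k = 3 * d + 1 \<or> k = 3 * d + 2 then 1 else 0)
      else if k \<le> d then 0 else if k \<le> 3 * d then - \<Lambda> else if k \<le> 3 * d + 2 then - 1 else 0)"
    for i j k
  \<comment> \<open>The shift between \<open>p (Suc i)\<close> and \<open>y i\<close> is deliberate:
    layer \<open>i + 1\<close> prepares the parts for cone \<open>i + 1\<close>, while its neuron
    \<open>3 * d + 2\<close> completes cone \<open>i\<close>, whose parts are already present in
    layer \<open>i\<close>.\<close>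
  define b where "b i j = (if i = LL - 1 then 0
      else if d < j \<and> j \<le> 2 * d then - p (Suc i) (j - d)
      else if 2 * d < j \<and> j \<le> 3 * d then p (Suc i) (j - 2 * d)
      else if j = 3 * d + 2 then y i else 0)" for i j
  have "\<bar>w i j k\<bar> \<le> c" for i j k
    unfolding w_def by (intro abs_if_le) (use c \<Lambda> in simp_all)
  moreover have "\<bar>b i j\<bar> \<le> c" for i j
    unfolding b_def by (intro abs_if_le) (use c p y in simp_all)
  ultimately obtain \<theta> where \<theta>: "\<And>q. \<bar>\<theta> q\<bar> \<le> c"
    "\<And>i j k. i < LL \<Longrightarrow> j \<in> {1..l (Suc i)} \<Longrightarrow> k \<in> {1..l i} \<Longrightarrow>
       \<theta> (param_count l i + ((j - 1) * l i + k)) = w i j k"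
    "\<And>i j. i < LL \<Longrightarrow> j \<in> {1..l (Suc i)} \<Longrightarrow> \<theta> (param_count l i + (l (Suc i) * l i + j)) = b i j"
    using parameters_of_weights[of w c b LL l] by blast
  have "network a l \<theta> LL x 1 = min (cone_max d p y \<Lambda> x (LL - 2)) 1"
    if x: "\<And>i. i \<in> {1..d} \<Longrightarrow> x i \<ge> 0" for x
  proof -
    let ?h = "\<lambda>i k. network a l \<theta> i x k"
    have step: "?h (Suc i) j = act (Suc i) ((\<Sum>k=1..l i. w i j k * ?h i k) + b i j)"
      if "i < LL" "j \<in> {1..l (Suc i)}" for i j
      unfolding network_step[OF that] preact_def \<theta>(3)[OF that]
      by (intro arg_cong[of _ _ "act (Suc i)"] arg_cong2[of _ _ _ _ "(+)"] sum.cong refl)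
        (simp add: \<theta>(2)[OF that, unfolded One_nat_def])
    have pick: "(\<Sum>k=1..l i. (if k = j then s else 0) * ?h i k) = s * ?h i j"
      if "j \<in> {1..d}" "i < LL" for i j s
    proof -
      have "j \<in> {1..l i}" using that wide[of i] l0 by (cases "i = 0") auto
      then show ?thesis by (simp add: if_distrib[of "\<lambda>u. u * _"] cong: if_cong)
    qed
    have first: "(\<forall>j\<in>{1..d}. ?h (Suc i) j = x j \<and> ?h (Suc i) (d + j) = max (x j - p (Suc i) j) 0
        \<and> ?h (Suc i) (2 * d + j) = max (p (Suc i) j - x j) 0)"
      if i: "Suc i < LL" and h: "\<forall>j\<in>{1..d}. ?h i j = x j" for i
    proof
      fix j assume j: "j \<in> {1..d}"
      have wd: "l (Suc i) \<ge> 3 * d + 2" using wide i by simp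
      have n: "i \<noteq> LL - 1" "Suc i \<noteq> LL" "i < LL" using i by auto
      have e: "w i j = (\<lambda>k. if k = j then 1 else 0)"
        "w i (d + j) = (\<lambda>k. if k = j then 1 else 0)"
        "w i (2 * d + j) = (\<lambda>k. if k = j then -1 else 0)"
        "b i j = 0" "b i (d + j) = - p (Suc i) j" "b i (2 * d + j) = p (Suc i) j"
        using n j by (auto simp: w_def b_def fun_eq_iff)
      have "?h (Suc i) j = max (x j) 0"
        using step[of i j] wd j n h pick[OF j n(3)] by (simp add: e act_def)
      moreover have "?h (Suc i) (d + j) = max (x j - p (Suc i) j) 0"
        using step[of i "d + j"] wd j n h pick[OF j n(3)] by (simp add: e act_def)
      moreover have "?h (Suc i) (2 * d + j) = max (p (Suc i) j - x j) 0"
        using step[of i "2 * d + j"] wd j n h pick[OF j n(3)] by (simp add: e act_def)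
      \<comment> \<open>Nonnegativity of the input lets the rectifier pass the carried copy
        unchanged.\<close>
      ultimately show "?h (Suc i) j = x j \<and> ?h (Suc i) (d + j) = max (x j - p (Suc i) j) 0
        \<and> ?h (Suc i) (2 * d + j) = max (p (Suc i) j - x j) 0"
        using x[OF j] by simp
    qed
    define H where "H t \<longleftrightarrow> (\<forall>j\<in>{1..d}. ?h t j = x j \<and> ?h t (d + j) = max (x j - p t j) 0
        \<and> ?h t (2 * d + j) = max (p t j - x j) 0) \<and> ?h t (3 * d + 1) \<ge> 0
        \<and> ?h t (3 * d + 1) + ?h t (3 * d + 2) = cone_max d p y \<Lambda> x (t - 1)" for t
    \<comment> \<open>Layer 0 consists of the \<open>d\<close> inputs alone, which the accumulator
      rows ignore; together with \<open>y 0 = 0\<close> this starts both accumulators at 0.\<close>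
    have base: "H 1"
    proof -
      have n: "0 \<noteq> LL - 1" "Suc 0 \<noteq> LL" "0 < LL" "Suc 0 < LL" using LL by auto
      have wd: "l 1 \<ge> 3 * d + 2" using wide LL by simp
      have "(\<Sum>k=1..l 0. w 0 (3 * d + 1) k * ?h 0 k) = 0" "(\<Sum>k=1..l 0. w 0 (3 * d + 2) k * ?h 0 k) = 0"
        using n by (auto simp: w_def l0 intro!: sum.neutral)
      then have "?h 1 (3 * d + 1) = 0" "?h 1 (3 * d + 2) = 0"
        using step[of 0 "3 * d + 1"] step[of 0 "3 * d + 2"] wd n y0 by (simp_all add: act_def b_def)
      then show ?thesis using first[of 0] n by (simp add: H_def)
    qed
    have cont: "H (Suc t)" if t: "1 \<le> t" "Suc t < LL" and H: "H t" for t
    proof -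
      have n: "t \<noteq> LL - 1" "Suc t \<noteq> LL" "t < LL" using t by auto
      have wd: "l t \<ge> 3 * d + 2" "l (Suc t) \<ge> 3 * d + 2" using wide t by simp_all
      have "(\<Sum>k=1..l t. w t (3 * d + 1) k * ?h t k) = ?h t (3 * d + 1) + ?h t (3 * d + 2)"
        using n wd by (subst sum_three_blocks[where d = d]) (auto simp: w_def intro!: sum.neutral)
      then have v: "?h (Suc t) (3 * d + 1) = max (cone_max d p y \<Lambda> x (t - 1)) 0"
        using step[of t "3 * d + 1"] wd n H by (simp add: act_def b_def H_def)
      have "(\<Sum>k=1..l t. w t (3 * d + 2) k * ?h t k)
          = (\<Sum>k=1..d. - \<Lambda> * (?h t (d + k) + ?h t (2 * d + k))) - ?h t (3 * d + 1) - ?h t (3 * d + 2)"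
        using n wd by (subst sum_three_blocks[where d = d])
          (auto simp: w_def algebra_simps intro!: sum.cong)
      also have "(\<Sum>k=1..d. - \<Lambda> * (?h t (d + k) + ?h t (2 * d + k))) = (\<Sum>k=1..d. - \<Lambda> * \<bar>x k - p t k\<bar>)"
        using H by (intro sum.cong) (auto simp: H_def)
      also have "\<dots> = - \<Lambda> * (\<Sum>k=1..d. \<bar>x k - p t k\<bar>)" by (simp add: sum_distrib_left)
      finally have sum: "(\<Sum>k=1..l t. w t (3 * d + 2) k * ?h t k)
          = - \<Lambda> * (\<Sum>k=1..d. \<bar>x k - p t k\<bar>) - cone_max d p y \<Lambda> x (t - 1)"
        using H by (simp add: H_def)
      have "?h (Suc t) (3 * d + 2) = act (Suc t) ((\<Sum>k=1..l t. w t (3 * d + 2) k * ?h t k) + b t (3 * d + 2))"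
        using n wd by (intro step) auto
      then have u: "?h (Suc t) (3 * d + 2) =
          max (y t - \<Lambda> * (\<Sum>k=1..d. \<bar>x k - p t k\<bar>) - cone_max d p y \<Lambda> x (t - 1)) 0"
        unfolding sum using n by (simp add: act_def b_def)
      have "cone_max d p y \<Lambda> x t
          = cone_max d p y \<Lambda> x (t - 1)
            + max (y t - \<Lambda> * (\<Sum>k=1..d. \<bar>x k - p t k\<bar>) - cone_max d p y \<Lambda> x (t - 1)) 0"
        using t by (cases t) (simp_all add: max_def)
      then show ?thesis
        using first[OF t(2)] H u v cone_max_nonneg[of d p y \<Lambda> x "t - 1"] by (simp add: H_def)
    qed
    \<comment> \<open>The first hidden layer only prepares the first cone, so \<open>LL - 1\<close>
      hidden layers take in \<open>LL - 2\<close> cones; the output layer merely adds up the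
      accumulators.\<close>
    have "t \<le> LL - 2 \<Longrightarrow> H (Suc t)" for t
      by (induction t) (use base cont LL in auto)
    from this[of "LL - 2"] have "H (LL - 1)" using LL by (simp add: numeral_2_eq_2 Suc_diff_Suc)
    then have H: "?h (LL - 1) (3 * d + 1) + ?h (LL - 1) (3 * d + 2) = cone_max d p y \<Lambda> x (LL - 2)"
      using LL by (simp add: H_def numeral_2_eq_2)
    obtain m where m: "LL = Suc m" using LL by (cases LL) auto
    have "l m \<ge> 3 * d + 2" using wide[of m] m LL by simp
    then have "(\<Sum>k=1..l m. w m 1 k * ?h m k) = ?h m (3 * d + 1) + ?h m (3 * d + 2)"
      by (subst sum_three_blocks[where d = d]) (auto simp: w_def m intro!: sum.neutral)
    moreover have "?h LL 1 = act LL ((\<Sum>k=1..l m. w m 1 k * ?h m k) + b m 1)"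
      using step[of m 1] l_LL by (simp add: m)
    moreover have "b m 1 = 0" by (simp add: b_def m)
    moreover have "?h m (3 * d + 1) + ?h m (3 * d + 2) = cone_max d p y \<Lambda> x (LL - 2)"
      using H by (simp add: m)
    ultimately have "?h LL 1 = max (min (cone_max d p y \<Lambda> x (LL - 2)) 1) 0"
      by (simp only: act_def) simp
    then show ?thesis using cone_max_nonneg[of d p y \<Lambda> x "LL - 2"] by simp
  qed
  then show ?thesis using \<theta>(1) by blast
qed

end

section \<open>Midpoint grids in boxes and the approximation rate\<close>

lemma interval_grid:
  fixes lo hi v :: real
  assumes "n \<ge> 1" "v \<in> {lo..hi}"
  shows "\<exists>k<n. \<bar>v - (lo + (2 * real k + 1) * ((hi - lo) / (2 * real n)))\<bar> \<le> (hi - lo) / (2 * real n)"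
proof (cases "lo = hi")
  case True
  then show ?thesis using assms by (intro exI[of _ 0]) auto
next
  case False
  define h where "h = (hi - lo) / (2 * real n)"
  have h: "h > 0" using False assms by (simp add: h_def)
  have n: "real n * (2 * h) = hi - lo" using assms by (simp add: h_def)
  define u where "u = (v - lo) / (2 * h)"
  have v: "v = lo + u * (2 * h)" using h by (simp add: u_def)
  have u: "0 \<le> u" "u \<le> real n"
    using assms h n by (auto simp: u_def divide_le_eq)
  \<comment> \<open>At the right end point \<open>u = n\<close>, and the floor would leave the index
    range; that point goes to the last cell.\<close>
  define k where "k = (if u < real n then nat \<lfloor>u\<rfloor> else n - 1)"
  have k: "k < n" "real k \<le> u" "u \<le> real k + 1"
    using u assms by (auto simp: k_def nat_less_iff floor_less_iff)
  have "v - (lo + (2 * real k + 1) * h) = (2 * u - 2 * real k - 1) * h"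
    by (simp add: v algebra_simps)
  moreover have "\<bar>2 * u - 2 * real k - 1\<bar> \<le> 1" using k by auto
  ultimately have "\<bar>v - (lo + (2 * real k + 1) * h)\<bar> \<le> h"
    using h by (simp add: abs_mult mult_le_cancel_right1)
  then show ?thesis using k by (auto simp: h_def)
qed

text \<open>Serves twice: for the centres of the cones in the unit cube and for the net of
  parameters. Extensional functions on \<open>S\<close> keep the family finite.\<close>

lemma box_grid:
  fixes S :: "'i set"
  assumes "finite S" "n \<ge> 1" "lo \<le> hi"
  shows "\<exists>F :: ('i \<Rightarrow> real) set. finite F \<and> F \<noteq> {} \<and> card F \<le> n ^ card S \<and>
    (\<forall>g\<in>F. \<forall>i\<in>S. g i \<in> {lo..hi}) \<and>
    (\<forall>f. (\<forall>i\<in>S. f i \<in> {lo..hi}) \<longrightarrow>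
       (\<exists>g\<in>F. \<forall>i\<in>S. \<bar>f i - g i\<bar> \<le> (hi - lo) / (2 * real n)))"
proof (intro exI conjI ballI allI impI)
  define q where "q k = lo + (2 * real k + 1) * ((hi - lo) / (2 * real n))" for k
  define F where "F = S \<rightarrow>\<^sub>E q ` {..<n}"
  show "finite F" using assms by (auto simp: F_def intro: finite_PiE)
  show "F \<noteq> {}" using assms by (auto simp: F_def PiE_eq_empty_iff lessThan_empty_iff)
  have "card F = card (q ` {..<n}) ^ card S" using assms by (simp add: F_def card_PiE)
  also have "\<dots> \<le> n ^ card S" using card_image_le[of "{..<n}" q] by (intro power_mono) auto
  finally show "card F \<le> n ^ card S" .
  have q: "q k \<in> {lo..hi}" if "k < n" for k
  proof -
    have "(2 * real k + 1) * ((hi - lo) / (2 * real n)) \<le> (2 * real n) * ((hi - lo) / (2 * real n))"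
      using that assms by (intro mult_right_mono) auto
    then show ?thesis using assms by (simp add: q_def)
  qed
  show "g i \<in> {lo..hi}" if "g \<in> F" "i \<in> S" for g i
    using PiE_mem[of g S "\<lambda>_. q ` {..<n}" i] that q by (auto simp: F_def)
  show "\<exists>g\<in>F. \<forall>i\<in>S. \<bar>f i - g i\<bar> \<le> (hi - lo) / (2 * real n)"
    if "\<forall>i\<in>S. f i \<in> {lo..hi}" for f
  proof -
    have "\<forall>i\<in>S. \<exists>k<n. \<bar>f i - q k\<bar> \<le> (hi - lo) / (2 * real n)"
      using interval_grid[OF assms(2)] that unfolding q_def by blast
    then obtain k where k: "\<And>i. i \<in> S \<Longrightarrow> k i < n \<and> \<bar>f i - q (k i)\<bar> \<le> (hi - lo) / (2 * real n)"
      by metis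
    then show ?thesis by (intro bexI[of _ "\<lambda>i\<in>S. q (k i)"]) (auto simp: F_def)
  qed
qed

lemma mem_unit_cube: "x \<in> unit_cube \<longleftrightarrow> (\<forall>i. x $ i \<in> {0..1})"
  by (simp add: unit_cube_def mem_box_cart)

lemma sum_to_tuple:
  assumes "bij_betw \<iota> {1..d} UNIV"
  shows "(\<Sum>i=1..d. \<bar>to_tuple d \<iota> x i - v (\<iota> i)\<bar>) = norm1 (x - (\<chi> i. v i))"
  unfolding norm1_def sum.reindex_bij_betw[OF assms, symmetric] by (simp add: to_tuple_def)

context clipped_relu_network
begin

text \<open>All cones lie below \<open>f\<close> by its Lipschitz bound, and at distance
  \<open>\<delta>\<close> from a centre their maximum misses \<open>f\<close> by at most
  \<open>2 * \<Lambda> * \<delta>\<close>. A grid with \<open>n\<close> values per axis gives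
  \<open>\<delta> \<le> d / (2 * n)\<close> and needs \<open>n ^ d\<close> cones, one per layer, so
  \<open>n\<close> may be of order \<open>A powr (1 / d)\<close>.\<close>

lemma network_approximation:
  fixes f :: "real ^ 'd::finite \<Rightarrow> real" and \<iota> :: "nat \<Rightarrow> 'd"
  defines "A \<equiv> real (Min ({LL} \<union> l ` {1..<LL}))"
  assumes d: "d \<ge> 1" and \<iota>: "bij_betw \<iota> {1..d} UNIV" and l0: "l 0 = d" and c: "c \<ge> max 2 L"
    and f: "f \<in> unit_cube \<rightarrow> {0..1}"
    and lip: "\<And>x y. x \<in> unit_cube \<Longrightarrow> y \<in> unit_cube \<Longrightarrow> \<bar>f x - f y\<bar> \<le> L * norm1 (x - y)"
    and small: "real d * c ^ 3 / A powr (1 / real d) < 1"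
  shows "\<exists>\<theta>. (\<forall>q. \<bar>\<theta> q\<bar> \<le> c) \<and> (\<forall>x\<in>unit_cube.
    \<bar>network a l \<theta> LL (to_tuple d \<iota> x) 1 - f x\<bar> \<le> real d * c ^ 3 / A powr (1 / real d))"
proof -
  define r where "r = A powr (1 / real d)"
  have A_le: "A \<le> real LL" "\<And>i. 1 \<le> i \<Longrightarrow> i < LL \<Longrightarrow> A \<le> real (l i)"
    unfolding A_def of_nat_le_iff by (rule Min_le; simp)+
  have "Min ({LL} \<union> l ` {1..<LL}) \<in> {LL} \<union> l ` {1..<LL}" by (intro Min_in) auto
  then have A1: "A \<ge> 1" using LL_pos l_pos by (auto simp: A_def)
  have r0: "r > 0" using A1 by (simp add: r_def)
  have rd: "r ^ d = A" using d A1 by (simp add: r_def powr_realpow[symmetric] powr_powr)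
  have c3: "c ^ 3 \<ge> 8" using c power_mono[of 2 c 3] by simp
  \<comment> \<open>This is the use of smallness: with \<open>r > 8 * d\<close> there is room for
    rounding \<open>n\<close>, for the two layers that add no cone and for the width
    \<open>3 * d + 2\<close>.\<close>
  have r_gt: "r > 8 * real d"
  proof -
    have "8 * real d \<le> c ^ 3 * real d" using c3 by (intro mult_right_mono) auto
    also have "\<dots> < r" using small r0 by (simp add: r_def[symmetric] divide_less_eq mult.commute)
    finally show ?thesis .
  qed
  have r8: "r \<ge> 8" using r_gt d by (smt (verit) of_nat_1 of_nat_mono)
  have rA: "r \<le> A" using self_le_power[of r d] r8 d rd by simp
  \<comment> \<open>At least \<open>r / 4\<close> for accuracy; rounding up costs at most 1, which
    is at most \<open>r / 8\<close>.\<close>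
  define n where "n = nat \<lceil>r / 4\<rceil>"
  have n: "r / 4 \<le> real n" "real n \<le> 3 / 8 * r" unfolding n_def using r8 by linarith+
  have n1: "n \<ge> 1" using n r8 by (cases n) auto
  have "real (n ^ d) \<le> (3 / 8 * r) ^ d" using n by (simp add: power_mono)
  also have "\<dots> = (3 / 8) ^ d * A" by (simp only: power_mult_distrib rd)
  also have "\<dots> \<le> 3 / 8 * A"
    using power_decreasing[of 1 d "3 / 8 :: real"] d A1 by (intro mult_right_mono) auto
  also have "\<dots> \<le> A - 2" using rA r8 by simp
  also have "\<dots> \<le> real LL - 2" using A_le by simp
  finally have nd: "n ^ d \<le> LL - 2" using rA r8 A_le by linarith
  have LL2: "LL \<ge> 2" using rA r8 A_le by linarith
  have wide: "l i \<ge> 3 * d + 2" if "1 \<le> i" "i < LL" for i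
    using A_le(2)[OF that] rA r_gt d by linarith
  have card: "CARD('d) = d" using bij_betw_same_card[OF \<iota>] by simp
  \<comment> \<open>\<open>L\<close> may be negative, but the slope of the cones must not
    be.\<close>
  define \<Lambda> where "\<Lambda> = max L 0"
  have \<Lambda>: "0 \<le> \<Lambda>" "\<Lambda> \<le> c" using c by (auto simp: \<Lambda>_def)
  have lip': "\<bar>f x - f y\<bar> \<le> \<Lambda> * norm1 (x - y)" if "x \<in> unit_cube" "y \<in> unit_cube" for x y
  proof -
    have "L * norm1 (x - y) \<le> \<Lambda> * norm1 (x - y)"
      by (intro mult_right_mono) (auto simp: \<Lambda>_def norm1_def intro!: sum_nonneg)
    then show ?thesis using lip[OF that] by linarith
  qed
  obtain F :: "('d \<Rightarrow> real) set" where F: "finite F" "F \<noteq> {}" "card F \<le> n ^ CARD('d)"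
    "\<forall>g\<in>F. \<forall>i. g i \<in> {0..1}"
    "\<forall>f. (\<forall>i. f i \<in> {0..1}) \<longrightarrow> (\<exists>g\<in>F. \<forall>i. \<bar>f i - g i\<bar> \<le> 1 / (2 * real n))"
    using box_grid[of "UNIV :: 'd set" n 0 1, OF finite_class.finite_UNIV n1 zero_le_one]
    unfolding ball_UNIV diff_zero by blast
  obtain e where e: "bij_betw e {1..card F} F" using ex_bij_betw_nat_finite_1[OF F(1)] by blast
  obtain g0 where g0: "g0 \<in> F" using F(2) by blast
  \<comment> \<open>The network takes exactly \<open>LL - 2\<close> cones, possibly more than there
    are grid points; repeating a grid point leaves the maximum unchanged.\<close>
  define v where "v t = (if t \<in> {1..card F} then e t else g0)" for t
  have vF: "v t \<in> F" for t using e g0 by (auto simp: v_def bij_betw_def)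
  have v_surj: "\<exists>t\<in>{1..LL - 2}. v t = g" if "g \<in> F" for g
  proof -
    have "g \<in> e ` {1..card F}" using that bij_betw_imp_surj_on[OF e] by simp
    then obtain t where "t \<in> {1..card F}" "e t = g" by blast
    then show ?thesis using F(3) nd card by (intro bexI[of _ t]) (auto simp: v_def)
  qed
  define z :: "nat \<Rightarrow> real ^ 'd" where "z t = (\<chi> i. v t i)" for t
  have z: "z t \<in> unit_cube" for t using F(4) vF by (simp add: mem_unit_cube z_def)
  define p where "p t i = v t (\<iota> i)" for t i
  define y where "y t = (if t = 0 then 0 else f (z t))" for t
  have "\<bar>p t i\<bar> \<le> c" "\<bar>y t\<bar> \<le> c" for t i
    using spec[OF bspec[OF F(4) vF[of t]], of "\<iota> i"] f z[of t] c by (auto simp: p_def y_def Pi_iff)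
  then obtain \<theta> where \<theta>: "\<And>q. \<bar>\<theta> q\<bar> \<le> c" "\<And>x. (\<forall>i\<in>{1..d}. x i \<ge> 0) \<Longrightarrow>
      network a l \<theta> LL x 1 = min (cone_max d p y \<Lambda> x (LL - 2)) 1"
    using network_cone_max[OF LL2 l0 wide _ \<Lambda>, of p y] c by (auto simp: y_def)
  have "\<bar>network a l \<theta> LL (to_tuple d \<iota> x) 1 - f x\<bar> \<le> real d * c ^ 3 / r" if x: "x \<in> unit_cube" for x
  proof -
    let ?m = "cone_max d p y \<Lambda> (to_tuple d \<iota> x) (LL - 2)"
    have dist: "(\<Sum>i=1..d. \<bar>to_tuple d \<iota> x i - p s i\<bar>) = norm1 (x - z s)" for s
      unfolding p_def z_def by (rule sum_to_tuple[OF \<iota>])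
    have fx: "f x \<in> {0..1}" using f x by auto
    have upper: "?m \<le> f x"
    proof (rule cone_max_le)
      fix s assume "s \<in> {1..LL - 2}"
      then show "y s - \<Lambda> * (\<Sum>i=1..d. \<bar>to_tuple d \<iota> x i - p s i\<bar>) \<le> f x"
        unfolding dist using lip'[OF x z[of s]] by (simp add: y_def)
    qed (use fx in simp)
    obtain g where g: "g \<in> F" "\<And>i. \<bar>x $ i - g i\<bar> \<le> 1 / (2 * real n)"
      using F(5)[rule_format, of "\<lambda>i. x $ i"] x unfolding mem_unit_cube by blast
    then obtain s where s: "s \<in> {1..LL - 2}" "v s = g" using v_surj by blast
    have "norm1 (x - z s) \<le> (\<Sum>i\<in>(UNIV :: 'd set). 1 / (2 * real n))"
      unfolding norm1_def z_def using g(2) s(2) by (intro sum_mono) simp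
    then have near: "norm1 (x - z s) \<le> real d / (2 * real n)" by (simp add: card)
    have "f x - 2 * (\<Lambda> * norm1 (x - z s)) \<le> y s - \<Lambda> * norm1 (x - z s)"
      using lip'[OF x z[of s]] s by (simp add: y_def)
    also have "\<dots> \<le> ?m" using cone_max_ge[OF s(1), where d = d and p = p and y = y and \<Lambda> = \<Lambda> and x = "to_tuple d \<iota> x"] unfolding dist .
    finally have lower: "f x - 2 * (\<Lambda> * norm1 (x - z s)) \<le> ?m" .
    have "2 * (\<Lambda> * norm1 (x - z s)) \<le> 2 * (c * (real d / (2 * real n)))"
      using \<Lambda> near c by (intro mult_left_mono mult_mono) (auto simp: norm1_def intro!: sum_nonneg)
    also have "\<dots> = c * real d / real n" by simp
    also have "\<dots> \<le> c * real d / (r / 4)" using n c r0 by (intro divide_left_mono) auto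
    also have "\<dots> = 4 * (c * real d) / r" by simp
    \<comment> \<open>The factor 4 caused by \<open>n \<ge> r / 4\<close> is absorbed by
      \<open>c ^ 2\<close>.\<close>
    also have "\<dots> \<le> c ^ 2 * (c * real d) / r"
      using power_mono[of 2 c 2] c r0 by (intro divide_right_mono mult_right_mono) auto
    also have "\<dots> = real d * c ^ 3 / r" by (simp add: power2_eq_square power3_eq_cube algebra_simps)
    finally have "2 * (\<Lambda> * norm1 (x - z s)) \<le> real d * c ^ 3 / r" .
    moreover have "network a l \<theta> LL (to_tuple d \<iota> x) 1 = ?m"
    proof -
      have "\<forall>i\<in>{1..d}. to_tuple d \<iota> x i \<ge> 0" using x by (simp add: mem_unit_cube to_tuple_def)
      then show ?thesis using \<theta>(2) upper fx by simp
    qed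
    ultimately show ?thesis using upper lower by linarith
  qed
  then show ?thesis using \<theta>(1) unfolding r_def by blast
qed

end

section \<open>Generalization and optimization in probability\<close>

lemma (in prob_space) expectation_square_le:
  fixes f :: "'a \<Rightarrow> real"
  assumes "integrable M f" "integrable M (\<lambda>x. (f x)\<^sup>2)"
  shows "(expectation f)\<^sup>2 \<le> expectation (\<lambda>x. (f x)\<^sup>2)"
  using variance_eq[OF assms] variance_positive[of f] by simp

lemma (in prob_space) iid_expectation:
  fixes g :: "'b::topological_space \<Rightarrow> real"
  assumes "iid M Z I" "i \<in> I" "j \<in> I" "g \<in> borel_measurable borel"
  shows "expectation (\<lambda>\<omega>. g (Z i \<omega>)) = expectation (\<lambda>\<omega>. g (Z j \<omega>))"
proof -
  have Z: "random_variable borel (Z k)" if "k \<in> I" for k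
    using assms(1) that by (auto simp: iid_def indep_vars_def)
  have "distr M borel (Z i) = distr M borel (Z j)"
    using assms unfolding iid_def by blast
  then show ?thesis
    using integral_distr[OF Z[OF assms(2)] assms(4)] integral_distr[OF Z[OF assms(3)] assms(4)] by simp
qed

text \<open>Independence factorizes the exponential of the mean, and Hoeffding's lemma with
  parameter \<open>s / n\<close> bounds each of the \<open>n\<close> factors. The position
  \<open>lo\<close> of the unit interval is left free so that both \<open>g\<close> and
  \<open>- g\<close> are covered, with \<open>lo = 0\<close> and \<open>lo = - 1\<close>.\<close>

lemma (in prob_space) iid_mean_mgf:
  fixes g :: "'b::topological_space \<Rightarrow> real"
  assumes iid: "iid M Z {1..}" and g: "g \<in> borel_measurable borel"
    and range: "\<And>j \<omega>. j \<ge> 1 \<Longrightarrow> \<omega> \<in> space M \<Longrightarrow> g (Z j \<omega>) \<in> {lo..lo + 1}"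
    and n: "n \<ge> 1" and s: "s > 0"
  defines "D \<equiv> \<lambda>\<omega>. (\<Sum>j=1..n. g (Z j \<omega>)) / real n - expectation (\<lambda>\<omega>. g (Z 1 \<omega>))"
  shows "integrable M (\<lambda>\<omega>. exp (s * D \<omega>))"
    and "expectation (\<lambda>\<omega>. exp (s * D \<omega>)) \<le> exp (s\<^sup>2 / (8 * real n))"
proof -
  define \<mu> where "\<mu> = expectation (\<lambda>\<omega>. g (Z 1 \<omega>))"
  define V where "V j \<omega> = exp (s / real n * (g (Z j \<omega>) - \<mu>))" for j \<omega>
  have ind: "indep_vars (\<lambda>_. borel) Z {1..}" using iid by (simp add: iid_def)
  have Z: "random_variable borel (Z j)" if "j \<in> {1..n}" for j
    using ind that by (auto simp: indep_vars_def)
  have V: "indep_vars (\<lambda>_. borel) V {1..n}"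
    unfolding V_def using g
    by (intro indep_vars_compose2[OF indep_vars_subset[OF ind]]) (auto intro!: measurable_compose[OF g])
  have mgf: "integrable M (V j) \<and> expectation (V j) \<le> exp (s\<^sup>2 / (8 * (real n)\<^sup>2))"
    if j: "j \<in> {1..n}" for j
  proof -
    have gZ: "random_variable borel (\<lambda>\<omega>. g (Z j \<omega>))" using measurable_compose[OF Z[OF j] g] .
    interpret interval_bounded_random_variable M "\<lambda>\<omega>. g (Z j \<omega>)" lo "lo + 1"
      using range j gZ by unfold_locales (auto intro!: AE_I2)
    have \<mu>: "expectation (\<lambda>\<omega>. g (Z j \<omega>)) = \<mu>"
      unfolding \<mu>_def using j by (intro iid_expectation[OF iid _ _ g]) auto
    \<comment> \<open>The nonnegative integral comes first: its finiteness is what yields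
      integrability of \<open>V j\<close>.\<close>
    have le: "(\<integral>\<^sup>+\<omega>. ennreal (V j \<omega>) \<partial>M) \<le> ennreal (exp (s\<^sup>2 / (8 * (real n)\<^sup>2)))"
      using Hoeffdings_lemma_nn_integral[of "s / real n"] s n
      by (simp add: V_def \<mu> power_divide mult.commute)
    have "V j \<in> borel_measurable M" using gZ by (simp add: V_def[abs_def])
    moreover have "(\<integral>\<^sup>+\<omega>. ennreal (norm (V j \<omega>)) \<partial>M) < \<infinity>"
      using le by (simp add: V_def) (meson ennreal_less_top le_less_trans)
    ultimately have int: "integrable M (V j)" by (intro integrableI_bounded)
    have "ennreal (expectation (V j)) \<le> ennreal (exp (s\<^sup>2 / (8 * (real n)\<^sup>2)))"
      using le nn_integral_eq_integral[OF int] by (simp add: V_def)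
    then show ?thesis using int by (simp add: ennreal_le_iff)
  qed
  have prod: "exp (s * D \<omega>) = (\<Prod>j=1..n. V j \<omega>)" for \<omega>
  proof -
    have "(\<Sum>j=1..n. s / real n * (g (Z j \<omega>) - \<mu>)) = s / real n * ((\<Sum>j=1..n. g (Z j \<omega>)) - real n * \<mu>)"
      unfolding sum_distrib_left[symmetric] sum_subtractf by simp
    also have "\<dots> = s * D \<omega>" using n by (simp add: D_def \<mu>_def field_simps)
    finally have "s * D \<omega> = (\<Sum>j=1..n. s / real n * (g (Z j \<omega>) - \<mu>))" ..
    then show ?thesis by (simp add: V_def exp_sum)
  qed
  show "integrable M (\<lambda>\<omega>. exp (s * D \<omega>))"
    unfolding prod using mgf by (intro indep_vars_integrable[OF _ V]) auto
  have "expectation (\<lambda>\<omega>. exp (s * D \<omega>)) = (\<Prod>j=1..n. expectation (V j))"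
    unfolding prod using mgf by (intro indep_vars_lebesgue_integral[OF _ V]) auto
  also have "\<dots> \<le> (\<Prod>j=1..n. exp (s\<^sup>2 / (8 * (real n)\<^sup>2)))"
    using mgf by (intro prod_mono) (auto simp: V_def intro!: integral_nonneg)
  also have "\<dots> = exp (real n * (s\<^sup>2 / (8 * (real n)\<^sup>2)))"
    unfolding exp_of_nat_mult by simp
  also have "real n * (s\<^sup>2 / (8 * (real n)\<^sup>2)) = s\<^sup>2 / (8 * real n)"
    using n by (simp add: power2_eq_square)
  finally show "expectation (\<lambda>\<omega>. exp (s * D \<omega>)) \<le> exp (s\<^sup>2 / (8 * real n))" .
qed

text \<open>
  The maximum over \<open>F\<close> is replaced by a sum of exponentials via \<open>z \<le> exp (z - b) + b - 1\<close>, with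
  \<open>z = sqrt n * \<bar>D g \<omega>\<bar>\<close> and \<open>b = ln (2 * card F) + 1 / 8\<close>.
\<close>

lemma (in prob_space) uniform_deviation:
  fixes F :: "('b::topological_space \<Rightarrow> real) set"
  assumes iid: "iid M Z {1..}" and F: "finite F" "F \<noteq> {}" "\<And>g. g \<in> F \<Longrightarrow> g \<in> borel_measurable borel"
    and range: "\<And>g j \<omega>. g \<in> F \<Longrightarrow> j \<ge> 1 \<Longrightarrow> \<omega> \<in> space M \<Longrightarrow> g (Z j \<omega>) \<in> {0..1}"
    and n: "n \<ge> 1"
  shows "\<exists>S. integrable M S \<and> expectation S \<le> (ln (2 * real (card F)) + 1 / 8) / sqrt (real n) \<and>
    (\<forall>g\<in>F. \<forall>\<omega>.
      \<bar>(\<Sum>j=1..n. g (Z j \<omega>)) / real n - expectation (\<lambda>\<omega>. g (Z 1 \<omega>))\<bar> \<le> S \<omega>)"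
proof (intro exI conjI ballI allI)
  define D where "D g \<omega> = (\<Sum>j=1..n. g (Z j \<omega>)) / real n - expectation (\<lambda>\<omega>. g (Z 1 \<omega>))" for g \<omega>
  define s where "s = sqrt (real n)"
  have s: "s > 0" "s\<^sup>2 = real n" using n by (auto simp: s_def)
  \<comment> \<open>Because \<open>s\<^sup>2 = n\<close>, each of the \<open>2 * card F\<close>
    exponentials has mean at most \<open>exp (1 / 8)\<close>. Multiplying by
    \<open>exp (- b)\<close> makes the mean of their sum at most 1, which cancels the
    \<open>- 1\<close> in \<open>S\<close>.\<close>
  define b where "b = ln (2 * real (card F)) + 1 / 8"
  have cF: "real (card F) > 0" using F by (simp add: card_gt_0_iff)
  have plus: "integrable M (\<lambda>\<omega>. exp (s * D g \<omega>)) \<and> expectation (\<lambda>\<omega>. exp (s * D g \<omega>)) \<le> exp (1 / 8)"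
    if "g \<in> F" for g
    using iid_mean_mgf[OF iid F(3)[OF that] _ n s(1), of 0] range[OF that] s n
    by (simp add: D_def)
  have minus: "integrable M (\<lambda>\<omega>. exp (- s * D g \<omega>)) \<and> expectation (\<lambda>\<omega>. exp (- s * D g \<omega>)) \<le> exp (1 / 8)"
    if "g \<in> F" for g
  proof -
    have "- s * D g \<omega> = s * ((\<Sum>j=1..n. - g (Z j \<omega>)) / real n - expectation (\<lambda>\<omega>. - g (Z 1 \<omega>)))" for \<omega>
      by (simp add: D_def sum_negf algebra_simps)
    moreover have "(\<lambda>x. - g x) \<in> borel_measurable borel" using F(3)[OF that] by simp
    ultimately show ?thesis
      using iid_mean_mgf[OF iid, of "\<lambda>x. - g x" "-1" n s] range[OF that] s n by simp
  qed
  define S where "S = (\<lambda>\<omega>. ((\<Sum>g\<in>F. exp (s * D g \<omega>) + exp (- s * D g \<omega>)) * exp (- b) + b - 1) / s)"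
  show "integrable M S"
    unfolding S_def using plus minus by (auto intro!: Bochner_Integration.integrable_sum)
  have "expectation S
      = ((\<Sum>g\<in>F. expectation (\<lambda>\<omega>. exp (s * D g \<omega>)) + expectation (\<lambda>\<omega>. exp (- s * D g \<omega>))) * exp (- b) + b - 1) / s"
    unfolding S_def using plus minus by (simp add: prob_space Bochner_Integration.integral_sum)
  also have "\<dots> \<le> ((\<Sum>g\<in>F. exp (1 / 8) + exp (1 / 8)) * exp (- b) + b - 1) / s"
    using plus minus s by (intro divide_right_mono diff_right_mono add_right_mono mult_right_mono
      sum_mono add_mono) auto
  also have "\<dots> = b / s"
  proof -
    have "(\<Sum>g\<in>F. exp (1 / 8) + exp (1 / 8)) * exp (- b) = (2 * real (card F)) * (exp (1 / 8) * exp (- b))"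
      by (simp add: distrib_left)
    also have "exp (1 / 8) * exp (- b) = exp (- ln (2 * real (card F)))"
      unfolding exp_add[symmetric] b_def by simp
    also have "\<dots> = 1 / (2 * real (card F))"
      using cF by (simp only: exp_minus exp_ln_iff[THEN iffD2] inverse_eq_divide mult_pos_pos zero_less_numeral)
    finally show ?thesis using cF by simp
  qed
  finally show "expectation S \<le> (ln (2 * real (card F)) + 1 / 8) / sqrt (real n)"
    by (simp add: b_def s_def)
  show "\<bar>(\<Sum>j=1..n. g (Z j \<omega>)) / real n - expectation (\<lambda>\<omega>. g (Z 1 \<omega>))\<bar> \<le> S \<omega>" if g: "g \<in> F" for g \<omega>
  proof -
    have "s * \<bar>D g \<omega>\<bar> - b + 1 \<le> exp (s * \<bar>D g \<omega>\<bar> - b)"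
      using exp_ge_add_one_self[of "s * \<bar>D g \<omega>\<bar> - b"] by linarith
    also have "\<dots> = exp (s * \<bar>D g \<omega>\<bar>) * exp (- b)" by (simp flip: exp_add)
    also have "\<dots> \<le> (exp (s * D g \<omega>) + exp (- s * D g \<omega>)) * exp (- b)"
      by (intro mult_right_mono) (auto simp: abs_if)
    also have "\<dots> \<le> (\<Sum>g\<in>F. exp (s * D g \<omega>) + exp (- s * D g \<omega>)) * exp (- b)"
      using g F(1) by (intro mult_right_mono member_le_sum) (auto simp: add_nonneg_nonneg)
    finally have "s * \<bar>D g \<omega>\<bar> \<le> s * S \<omega>" using s by (simp add: S_def)
    then show ?thesis using s by (simp add: D_def)
  qed
qed

section \<open>Uniform initializations, parameter nets and the excess risk\<close>

lemma closed_near: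
  fixes A :: "'p::finite set" and z :: "real ^ 'p"
  shows "closed {x. \<forall>i\<in>A. \<bar>x $ i - z $ i\<bar> \<le> r}"
  unfolding Collect_ball_eq by (intro closed_INT ballI closed_Collect_le continuous_intros)

text \<open>The point \<open>z\<close> may sit on the boundary, where a box centred at
  \<open>z\<close> would leave the cube. Contracting the cube towards \<open>z\<close> by the factor
  \<open>\<tau>\<close> in the coordinates of \<open>A\<close> stays inside and keeps the fraction
  \<open>\<tau> ^ card A\<close> of the volume.\<close>

lemma measure_uniform_near:
  fixes A :: "'p::finite set" and z :: "real ^ 'p"
  assumes c: "c > 0" and z: "\<And>i. i \<in> A \<Longrightarrow> z $ i \<in> {-c..c}" and \<tau>: "0 \<le> \<tau>" "\<tau> \<le> 1"
  shows "measure (uniform_measure lborel (cbox (\<chi> i. -c) (\<chi> i. c)))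
      {x. \<forall>i\<in>A. \<bar>x $ i - z $ i\<bar> \<le> 2 * c * \<tau>} \<ge> \<tau> ^ card A"
proof -
  define Q :: "(real ^ 'p) set" where "Q = cbox (\<chi> i. -c) (\<chi> i. c)"
  define B where "B = {x. \<forall>i\<in>A. \<bar>x $ i - z $ i\<bar> \<le> 2 * c * \<tau>}"
  have "closed B" unfolding B_def by (rule closed_near)
  then have B: "B \<in> sets lborel" by simp
  \<comment> \<open>an interval of length \<open>2 * c * \<tau>\<close> inside \<open>[-c, c]\<close> that contains \<open>z $ i\<close>\<close>
  define u where "u i = (if i \<in> A then (1 - \<tau>) * z $ i - c * \<tau> else - c)" for i
  define v where "v i = (if i \<in> A then (1 - \<tau>) * z $ i + c * \<tau> else c)" for i
  have uv: "u i \<le> v i" for i using c \<tau> by (simp add: u_def v_def)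
  have close: "u i \<ge> -c \<and> v i \<le> c \<and> z $ i - 2 * c * \<tau> \<le> u i \<and> v i \<le> z $ i + 2 * c * \<tau>" if i: "i \<in> A" for i
  proof -
    have "(1 - \<tau>) * z $ i \<le> (1 - \<tau>) * c" "(1 - \<tau>) * (- c) \<le> (1 - \<tau>) * z $ i"
      using z[OF i] \<tau> by (intro mult_left_mono; simp)+
    moreover have "\<tau> * z $ i \<le> \<tau> * c" "\<tau> * (- c) \<le> \<tau> * z $ i"
      using z[OF i] \<tau> by (intro mult_left_mono; simp)+
    ultimately show ?thesis using i by (simp add: u_def v_def algebra_simps)
  qed
  have sub: "cbox (\<chi> i. u i) (\<chi> i. v i) \<subseteq> Q \<inter> B"
  proof
    fix x assume x: "x \<in> cbox (\<chi> i. u i) (\<chi> i. v i)"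
    have xi: "u i \<le> x $ i" "x $ i \<le> v i" for i using x by (simp_all add: mem_box_cart)
    have "- c \<le> x $ i \<and> x $ i \<le> c" for i
      using close[of i] xi[of i] by (cases "i \<in> A") (auto simp: u_def v_def)
    moreover have "\<bar>x $ i - z $ i\<bar> \<le> 2 * c * \<tau>" if "i \<in> A" for i
      using close[OF that] xi[of i] by (simp add: abs_le_iff)
    ultimately show "x \<in> Q \<inter> B" by (simp add: Q_def B_def mem_box_cart)
  qed
  have Qne: "Q \<noteq> {}" using c by (auto simp: Q_def interval_ne_empty_cart)
  have Q: "measure lborel Q = (2 * c) ^ CARD('p)"
    using Qne by (simp add: Q_def content_cbox_cart)
  have box_ne: "cbox (\<chi> i. u i) (\<chi> i. v i) \<noteq> {}" using uv by (simp add: interval_ne_empty_cart)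
  have "measure lborel (cbox (\<chi> i. u i) (\<chi> i. v i)) = (\<Prod>i\<in>UNIV. v i - u i)"
    using content_cbox_cart[OF box_ne] by simp
  also have "\<dots> = (\<Prod>i\<in>UNIV. 2 * c * (if i \<in> A then \<tau> else 1))"
    by (intro prod.cong) (auto simp: u_def v_def algebra_simps)
  also have "\<dots> = (2 * c) ^ CARD('p) * \<tau> ^ card A"
    unfolding prod.distrib by (simp add: prod.If_cases)
  finally have vol: "measure lborel (cbox (\<chi> i. u i) (\<chi> i. v i)) = (2 * c) ^ CARD('p) * \<tau> ^ card A" .
  have "emeasure lborel (Q \<inter> B) \<le> emeasure lborel Q" by (rule emeasure_mono) (simp_all add: Q_def)
  also have "\<dots> < \<infinity>" unfolding Q_def by (rule emeasure_lborel_cbox_finite)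
  finally have fm: "Q \<inter> B \<in> fmeasurable lborel" using B by (intro fmeasurableI) (simp_all add: Q_def)
  have "(2 * c) ^ CARD('p) * \<tau> ^ card A \<le> measure lborel (Q \<inter> B)"
    unfolding vol[symmetric] using measure_mono_fmeasurable[OF sub _ fm]
    by simp
  then have "\<tau> ^ card A \<le> measure lborel (Q \<inter> B) / measure lborel Q"
    using c by (simp add: Q le_divide_eq mult.commute)
  also have "\<dots> = measure (uniform_measure lborel Q) B"
  proof (rule measure_uniform_measure[symmetric])
    show "emeasure lborel Q \<noteq> 0"
      using Q c by (metis enn2real_0 measure_def power_not_zero mult_eq_0_iff less_irrefl zero_neq_numeral)
    show "emeasure lborel Q \<noteq> \<infinity>"
      unfolding Q_def using emeasure_lborel_cbox_finite by (metis less_irrefl)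
  qed (use B in simp)
  finally show ?thesis by (simp add: Q_def B_def)
qed

lemma (in prob_space) prob_all_far:
  fixes \<Theta> :: "nat \<Rightarrow> 'a \<Rightarrow> real ^ 'p::finite" and A :: "'p set"
  assumes iid: "iid M \<Theta> {1..}"
    and unif: "distr M borel (\<Theta> 1) = uniform_measure lborel (cbox (\<chi> i. -c) (\<chi> i. c))"
    and c: "c > 0" and z: "\<And>i. i \<in> A \<Longrightarrow> z $ i \<in> {-c..c}" and \<tau>: "0 \<le> \<tau>" "\<tau> \<le> 1" and K: "K \<ge> 1"
  defines "B \<equiv> {\<omega> \<in> space M. \<forall>k\<in>{1..K}. \<not> (\<forall>i\<in>A. \<bar>\<Theta> k \<omega> $ i - z $ i\<bar> \<le> 2 * c * \<tau>)}"
  shows "B \<in> events" "prob B \<le> (1 - \<tau> ^ card A) ^ K"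
proof -
  define N where "N = {x. \<forall>i\<in>A. \<bar>x $ i - z $ i\<bar> \<le> 2 * c * \<tau>}"
  have "closed N" unfolding N_def by (rule closed_near)
  then have N: "N \<in> sets borel" by simp
  have ind: "indep_vars (\<lambda>_. borel) \<Theta> {1..}" using iid by (simp add: iid_def)
  have rv: "random_variable borel (\<Theta> k)" if "k \<ge> 1" for k
    using ind that by (auto simp: indep_vars_def)
  have B: "B = (\<Inter>k\<in>{1..K}. \<Theta> k -` (- N) \<inter> space M)" using K by (auto simp: B_def N_def)
  show "B \<in> events" unfolding B using rv N K by (intro sets.finite_INT) (auto intro!: measurable_sets)
  have "prob B = (\<Prod>k\<in>{1..K}. prob (\<Theta> k -` (- N) \<inter> space M))"
    unfolding B using K N by (intro indep_varsD[OF ind]) auto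
  also have "\<dots> \<le> (\<Prod>k\<in>{1..K}. 1 - \<tau> ^ card A)"
  proof (intro prod_mono conjI measure_nonneg)
    fix k assume k: "k \<in> {1..K}"
    have "distr M borel (\<Theta> k) = distr M borel (\<Theta> 1)"
      using iid k unfolding iid_def atLeast_iff atLeastAtMost_iff by blast
    then have "\<tau> ^ card A \<le> measure (distr M borel (\<Theta> k)) N"
      unfolding unif N_def using measure_uniform_near[OF c z \<tau>] by simp
    also have "\<dots> = prob (\<Theta> k -` N \<inter> space M)" using rv k N by (intro measure_distr) auto
    finally have "1 - prob (\<Theta> k -` N \<inter> space M) \<le> 1 - \<tau> ^ card A" by simp
    moreover have "\<Theta> k -` (- N) \<inter> space M = space M - (\<Theta> k -` N \<inter> space M)" by auto
    moreover have "\<Theta> k -` N \<inter> space M \<in> events" using rv k N by (auto intro!: measurable_sets)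
    ultimately show "prob (\<Theta> k -` (- N) \<inter> space M) \<le> 1 - \<tau> ^ card A" by (simp add: prob_compl)
  qed
  finally show "prob B \<le> (1 - \<tau> ^ card A) ^ K" by simp
qed

text \<open>Bernoulli's inequality bounds \<open>K * t\<close> by \<open>(1 + t) ^ K\<close>, and
  \<open>(1 - t) * (1 + t) \<le> 1\<close>. A bound that is a pure power of \<open>K\<close> and
  \<open>t\<close> can be balanced exactly in \<open>optimization_rate\<close>.\<close>

lemma one_minus_power_le_inverse:
  fixes t :: real
  assumes "0 < t" "t \<le> 1" "K \<ge> 1"
  shows "(1 - t) ^ K \<le> 1 / (real K * t)"
proof -
  have "1 + real K * t \<le> (1 + t) ^ K" using assms Bernoulli_inequality[of t K] by simp
  then have "(1 - t) ^ K * (real K * t) \<le> (1 - t) ^ K * (1 + t) ^ K"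
    using assms by (intro mult_left_mono) auto
  also have "\<dots> = ((1 - t) * (1 + t)) ^ K" by (simp add: power_mult_distrib)
  also have "\<dots> \<le> 1" using assms by (intro power_le_one) (auto simp: algebra_simps mult_le_one)
  finally show ?thesis using assms by (simp add: le_divide_eq)
qed

text \<open>A net of covering radius \<open>c / m\<close> reduces the family to finitely many
  functions; off the net the Lipschitz bound is paid twice, for the empirical mean and for the
  expectation. Since \<open>S\<close> is the same for all parameters, it still applies to a
  parameter chosen from the data.\<close>

lemma (in prob_space) uniform_deviation_lipschitz:
  fixes f :: "real ^ 'p::finite \<Rightarrow> 'b::topological_space \<Rightarrow> real" and A :: "'p set"
  assumes iid: "iid M Z {1..}" and f: "\<And>\<theta>. f \<theta> \<in> borel_measurable borel"
    and range: "\<And>\<theta> j \<omega>. j \<ge> 1 \<Longrightarrow> \<omega> \<in> space M \<Longrightarrow> f \<theta> (Z j \<omega>) \<in> {0..1}"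
    and lip: "\<And>\<theta> \<eta> j \<omega> \<epsilon>. \<forall>i\<in>A. \<theta> $ i \<in> {-c..c} \<Longrightarrow> \<forall>i\<in>A. \<eta> $ i \<in> {-c..c} \<Longrightarrow>
      \<forall>i\<in>A. \<bar>\<theta> $ i - \<eta> $ i\<bar> \<le> \<epsilon> \<Longrightarrow> j \<ge> 1 \<Longrightarrow> \<omega> \<in> space M \<Longrightarrow>
      \<bar>f \<theta> (Z j \<omega>) - f \<eta> (Z j \<omega>)\<bar> \<le> B * \<epsilon>"
    and c: "c > 0" and n: "n \<ge> 1" and m: "m \<ge> 1"
  shows "\<exists>S. integrable M S \<and>
    expectation S \<le> (ln (2 * real m ^ card A) + 1 / 8) / sqrt (real n) + 2 * (B * (c / real m)) \<and>
    (\<forall>\<theta>. (\<forall>i\<in>A. \<theta> $ i \<in> {-c..c}) \<longrightarrow> (\<forall>\<omega>\<in>space M.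
      \<bar>(\<Sum>j=1..n. f \<theta> (Z j \<omega>)) / real n - expectation (\<lambda>\<omega>. f \<theta> (Z 1 \<omega>))\<bar> \<le> S \<omega>))"
proof -
  have fin: "finite A" and cc: "- c \<le> c" using c by simp_all
  obtain F :: "('p \<Rightarrow> real) set" where F: "finite F" "F \<noteq> {}" "card F \<le> m ^ card A"
    "\<forall>g\<in>F. \<forall>i\<in>A. g i \<in> {-c..c}"
    "\<forall>h. (\<forall>i\<in>A. h i \<in> {-c..c}) \<longrightarrow>
       (\<exists>g\<in>F. \<forall>i\<in>A. \<bar>h i - g i\<bar> \<le> (c - - c) / (2 * real m))"
    using box_grid[OF fin m cc] by blast
  define G where "G = (\<lambda>g. f (\<chi> i. g i)) ` F"
  have G: "finite G" "G \<noteq> {}" using F by (auto simp: G_def)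
  have cG: "0 < card G" "card G \<le> m ^ card A"
    using G F card_image_le[OF F(1), of "\<lambda>g. f (\<chi> i. g i)"] by (auto simp: G_def card_gt_0_iff)
  obtain S where S: "integrable M S"
    "expectation S \<le> (ln (2 * real (card G)) + 1 / 8) / sqrt (real n)"
    "\<And>g \<omega>. g \<in> G \<Longrightarrow>
      \<bar>(\<Sum>j=1..n. g (Z j \<omega>)) / real n - expectation (\<lambda>\<omega>. g (Z 1 \<omega>))\<bar> \<le> S \<omega>"
    using uniform_deviation[OF iid G _ _ n] f range unfolding G_def by blast
  have Z: "random_variable borel (Z j)" if "j \<ge> 1" for j
    using iid that by (auto simp: iid_def indep_vars_def)
  have int: "integrable M (\<lambda>\<omega>. f \<theta> (Z 1 \<omega>))" for \<theta>
    using range[of 1 _ \<theta>] measurable_compose[OF Z f]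
    by (intro integrable_const_bound[of _ 1] AE_I2) auto
  let ?\<delta> = "B * (c / real m)"
  let ?S = "\<lambda>\<omega>. S \<omega> + 2 * ?\<delta>"
  have "real (card G) \<le> real m ^ card A" using cG(2) by (metis of_nat_le_iff of_nat_power)
  then have "ln (2 * real (card G)) \<le> ln (2 * real m ^ card A)" using cG(1) m by simp
  then have "(ln (2 * real (card G)) + 1 / 8) / sqrt (real n)
      \<le> (ln (2 * real m ^ card A) + 1 / 8) / sqrt (real n)"
    by (intro divide_right_mono) auto
  then have "expectation ?S \<le> (ln (2 * real m ^ card A) + 1 / 8) / sqrt (real n) + 2 * ?\<delta>"
    using S(1,2) by (simp add: prob_space)
  moreover have "integrable M ?S" using S(1) by simp
  moreover have "\<bar>(\<Sum>j=1..n. f \<theta> (Z j \<omega>)) / real n - expectation (\<lambda>\<omega>. f \<theta> (Z 1 \<omega>))\<bar> \<le> ?S \<omega>"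
    if \<theta>: "\<forall>i\<in>A. \<theta> $ i \<in> {-c..c}" and \<omega>: "\<omega> \<in> space M" for \<theta> \<omega>
  proof -
    obtain g where g: "g \<in> F" "\<forall>i\<in>A. \<bar>\<theta> $ i - g i\<bar> \<le> (c - - c) / (2 * real m)"
      using F(5)[rule_format, of "\<lambda>i. \<theta> $ i"] \<theta> by blast
    define \<eta> where "\<eta> = (\<chi> i. g i)"
    have close: "\<forall>i\<in>A. \<bar>\<theta> $ i - \<eta> $ i\<bar> \<le> c / real m" using g(2) by (simp add: \<eta>_def)
    have \<eta>: "\<forall>i\<in>A. \<eta> $ i \<in> {-c..c}" using F(4) g(1) by (simp add: \<eta>_def)
    have pt: "\<bar>f \<theta> (Z j \<omega>) - f \<eta> (Z j \<omega>)\<bar> \<le> ?\<delta>" if "j \<ge> 1" "\<omega> \<in> space M" for j \<omega>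
      by (rule lip[OF \<theta> \<eta> close that])
    have "\<bar>(\<Sum>j=1..n. f \<theta> (Z j \<omega>)) - (\<Sum>j=1..n. f \<eta> (Z j \<omega>))\<bar> \<le> (\<Sum>j=1..n. ?\<delta>)"
      unfolding sum_subtractf[symmetric]
      using pt \<omega> by (intro order_trans[OF sum_abs] sum_mono) auto
    then have "\<bar>(\<Sum>j=1..n. f \<theta> (Z j \<omega>)) - (\<Sum>j=1..n. f \<eta> (Z j \<omega>))\<bar> / real n \<le> ?\<delta>"
      using n by (simp add: divide_le_eq mult.commute)
    then have emp: "\<bar>(\<Sum>j=1..n. f \<theta> (Z j \<omega>)) / real n - (\<Sum>j=1..n. f \<eta> (Z j \<omega>)) / real n\<bar> \<le> ?\<delta>"
      using n by (simp add: diff_divide_distrib[symmetric])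
    have "\<bar>expectation (\<lambda>\<omega>. f \<theta> (Z 1 \<omega>)) - expectation (\<lambda>\<omega>. f \<eta> (Z 1 \<omega>))\<bar>
        = \<bar>expectation (\<lambda>\<omega>. f \<theta> (Z 1 \<omega>) - f \<eta> (Z 1 \<omega>))\<bar>"
      using int by simp
    also have "\<dots> \<le> expectation (\<lambda>\<omega>. \<bar>f \<theta> (Z 1 \<omega>) - f \<eta> (Z 1 \<omega>)\<bar>)"
      by (rule integral_abs_bound)
    also have "\<dots> \<le> expectation (\<lambda>\<omega>. ?\<delta>)" using int pt by (intro integral_mono) auto
    finally have "\<bar>expectation (\<lambda>\<omega>. f \<theta> (Z 1 \<omega>)) - expectation (\<lambda>\<omega>. f \<eta> (Z 1 \<omega>))\<bar> \<le> ?\<delta>"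
      by (simp add: prob_space)
    moreover have "\<bar>(\<Sum>j=1..n. f \<eta> (Z j \<omega>)) / real n - expectation (\<lambda>\<omega>. f \<eta> (Z 1 \<omega>))\<bar> \<le> S \<omega>"
      using g(1) by (intro S(3)) (auto simp: G_def \<eta>_def)
    ultimately show ?thesis using emp by linarith
  qed
  ultimately show ?thesis by blast
qed

text \<open>Pythagoras in L2: the difference of \<open>h\<close> and \<open>e\<close> at
  \<open>X\<close> is measurable with respect to \<open>X\<close>, hence orthogonal to
  \<open>Y\<close> minus its conditional expectation, and the cross term vanishes.\<close>

lemma (in prob_space) excess_risk:
  fixes h e :: "'b::topological_space \<Rightarrow> real"
  assumes X: "random_variable borel X" and Y: "random_variable borel Y"
    and Y01: "\<And>\<omega>. \<omega> \<in> space M \<Longrightarrow> Y \<omega> \<in> {0..1}"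
    and h: "h \<in> borel_measurable borel" "\<And>x. h x \<in> {0..1}"
    and e: "e \<in> borel_measurable borel" "\<And>x. e x \<in> {0..1}"
    and cond: "AE \<omega> in M. e (X \<omega>) = cond_exp_given M Y X \<omega>"
  shows "expectation (\<lambda>\<omega>. (h (X \<omega>) - Y \<omega>)\<^sup>2)
    = expectation (\<lambda>\<omega>. (h (X \<omega>) - e (X \<omega>))\<^sup>2) + expectation (\<lambda>\<omega>. (e (X \<omega>) - Y \<omega>)\<^sup>2)"
proof -
  define F where "F = vimage_algebra (space M) X borel"
  have sub: "subalgebra M F"
    unfolding subalgebra_def F_def using X by (auto simp: sets_vimage_algebra2 measurable_sets)
  interpret finite_measure_subalgebra M F by unfold_locales (rule sub)
  have XF: "X \<in> measurable F borel" unfolding F_def by (rule measurable_vimage_algebra1) auto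
  note [measurable] = X Y h(1) e(1)
  let ?u = "\<lambda>\<omega>. h (X \<omega>) - e (X \<omega>)"
  have u: "?u \<in> borel_measurable F"
    using measurable_compose[OF XF h(1)] measurable_compose[OF XF e(1)] by simp
  have bd: "\<bar>?u \<omega>\<bar> \<le> 1" for \<omega> using h(2)[of "X \<omega>"] e(2)[of "X \<omega>"] by auto
  have bd': "\<bar>e (X \<omega>) - Y \<omega>\<bar> \<le> 1" if "\<omega> \<in> space M" for \<omega>
    using e(2)[of "X \<omega>"] Y01[OF that] by auto
  have prod_int: "integrable M (\<lambda>\<omega>. p \<omega> * q \<omega>)"
    if "random_variable borel p" "random_variable borel q"
      "\<And>\<omega>. \<omega> \<in> space M \<Longrightarrow> \<bar>p \<omega>\<bar> \<le> 1" "\<And>\<omega>. \<omega> \<in> space M \<Longrightarrow> \<bar>q \<omega>\<bar> \<le> 1" for p q :: "'a \<Rightarrow> real"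
    using that by (intro integrable_const_bound[of _ 1] AE_I2) (auto simp: abs_mult intro!: mult_le_one)
  have int: "integrable M (\<lambda>\<omega>. ?u \<omega> * Y \<omega>)" "integrable M (\<lambda>\<omega>. ?u \<omega> * e (X \<omega>))"
    "integrable M (\<lambda>\<omega>. (?u \<omega>)\<^sup>2)" "integrable M (\<lambda>\<omega>. (e (X \<omega>) - Y \<omega>)\<^sup>2)"
    unfolding power2_eq_square using bd bd' Y01 e(2) by (intro prod_int; auto)+
  have "expectation (\<lambda>\<omega>. ?u \<omega> * e (X \<omega>)) = expectation (\<lambda>\<omega>. ?u \<omega> * real_cond_exp M F Y \<omega>)"
    using cond by (intro integral_cong_AE) (auto simp: cond_exp_given_def F_def)
  also have "\<dots> = expectation (\<lambda>\<omega>. ?u \<omega> * Y \<omega>)"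
    by (rule real_cond_exp_intg(2)[OF int(1) u Y])
  finally have "expectation (\<lambda>\<omega>. 2 * (?u \<omega> * e (X \<omega>)) - 2 * (?u \<omega> * Y \<omega>)) = 0"
    using int by simp
  moreover have "expectation (\<lambda>\<omega>. (h (X \<omega>) - Y \<omega>)\<^sup>2)
      = expectation (\<lambda>\<omega>. (?u \<omega>)\<^sup>2 + (e (X \<omega>) - Y \<omega>)\<^sup>2 + (2 * (?u \<omega> * e (X \<omega>)) - 2 * (?u \<omega> * Y \<omega>)))"
    by (intro Bochner_Integration.integral_cong refl) (simp add: power2_eq_square algebra_simps)
  ultimately show ?thesis using int by simp
qed

section \<open>The square loss and the explicit rates\<close>

lemma square_loss_lipschitz:
  fixes u v y :: real
  assumes "u \<in> {0..1}" "v \<in> {0..1}" "y \<in> {0..1}"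
  shows "\<bar>(u - y)\<^sup>2 - (v - y)\<^sup>2\<bar> \<le> 2 * \<bar>u - v\<bar>"
proof -
  have "(u - y)\<^sup>2 - (v - y)\<^sup>2 = (u - v) * (u + v - 2 * y)"
    by (simp add: power2_eq_square algebra_simps)
  moreover have "\<bar>u + v - 2 * y\<bar> \<le> 2" using assms by auto
  ultimately show ?thesis
    using mult_left_mono[of "\<bar>u + v - 2 * y\<bar>" 2 "\<bar>u - v\<bar>"] by (simp add: abs_mult mult.commute)
qed

text \<open>In use, \<open>n\<close> is the depth and \<open>D\<close> the number of active
  parameters. With \<open>q = M powr (1 / 4)\<close>, the condition \<open>T < 1\<close> forces
  \<open>q \<ge> 4 * c * n * W\<close>, so \<open>M ^ n = q ^ (4 * n)\<close> grid values outweigh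
  the Lipschitz constant, and discretization costs at most \<open>1 / q\<^sup>2\<close>. So fine a
  net enters only through \<open>n * D * ln M \<le> (n * W)\<^sup>2 * ln M\<close>.\<close>

lemma generalization_rate:
  fixes c W :: real and M n D :: nat
  assumes M: "M \<ge> 1" and c: "c \<ge> 2" and W: "W \<ge> 2" and n: "n \<ge> 1" and D: "real D \<le> real n * W\<^sup>2"
  defines "T \<equiv> c ^ 3 * real n * W * ln (exp 1 * real M) / real M powr (1 / 4)"
  assumes T: "T < 1"
  shows "2 * ((ln (2 * real (M ^ n) ^ D) + 1 / 8) / sqrt (real M)
    + 2 * (2 * (real n * (c * W) ^ n / c) * (c / real (M ^ n)))) \<le> T\<^sup>2"
proof -
  define q where "q = real M powr (1 / 4)"
  define m where "m = ln (exp 1 * real M)"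
  have m_eq: "m = 1 + ln (real M)" using M by (simp add: m_def ln_mult)
  have lnM: "ln (real M) \<ge> 0" using M by simp
  have m1: "m \<ge> 1" using m_eq lnM by simp
  have q0: "q > 0" using M by (simp add: q_def)
  have q4: "q ^ 4 = real M" using M by (simp add: q_def powr_realpow[symmetric] powr_powr)
  have q2: "q\<^sup>2 = sqrt (real M)"
    by (rule real_sqrt_unique[symmetric]) (use q4 in \<open>simp_all flip: power_mult\<close>)
  have n1: "real n \<ge> 1" using n by simp
  have nW: "real n * W \<ge> 2" using n1 W mult_mono[of 1 "real n" 2 W] by simp
  have "c ^ 3 * real n * W * 1 \<le> c ^ 3 * real n * W * m"
    using m1 c W n1 by (intro mult_left_mono) auto
  also have "\<dots> < q" using T q0 by (simp add: T_def m_def q_def divide_less_eq)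
  finally have q_gt: "c ^ 3 * (real n * W) < q" by (simp add: mult.assoc)
  have "4 * c \<le> c ^ 3" using power_mono[of 2 c 2] c mult_right_mono[of 4 "c\<^sup>2" c]
    by (simp add: power3_eq_cube power2_eq_square)
  then have q_gt': "4 * c * (real n * W) \<le> q"
    using q_gt nW mult_right_mono[of "4 * c" "c ^ 3" "real n * W"] by simp
  have q1: "q \<ge> 1" 
  proof -
    have "8 * 2 \<le> 4 * c * (real n * W)" using c nW by (intro mult_mono) auto
    then show ?thesis using q_gt' by linarith
  qed
  have second: "2 * (2 * (real n * (c * W) ^ n / c) * (c / real (M ^ n))) \<le> 1 / q\<^sup>2"
  proof -
    have "2 * (2 * (real n * (c * W) ^ n / c) * (c / real (M ^ n))) = (4 * real n) * (c * W) ^ n / q ^ (4 * n)"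
      using c by (simp add: q4 power_mult)
    \<comment> \<open>Enlarging \<open>4 * n\<close> to its own power collects everything into one
      \<open>n\<close>-th power, which \<open>q_gt'\<close> compares with
      \<open>q ^ n\<close>.\<close>
    also have "\<dots> \<le> (4 * real n) ^ n * (c * W) ^ n / q ^ (4 * n)"
      using self_le_power[of "4 * real n" n] n n1 c W q0
      by (intro divide_right_mono mult_right_mono) auto
    also have "\<dots> = (4 * c * (real n * W)) ^ n / q ^ (4 * n)"
      by (simp only: power_mult_distrib mult_ac)
    also have "\<dots> \<le> q ^ n / q ^ (4 * n)"
      using q_gt' q0 c W by (intro divide_right_mono power_mono) auto
    also have "\<dots> = 1 / q ^ (3 * n)"
      using q0 by (simp add: field_simps flip: power_add)
    also have "\<dots> \<le> 1 / q\<^sup>2"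
      using q1 n q0 by (intro divide_left_mono power_increasing) auto
    finally show ?thesis .
  qed
  have nW2: "(real n * W)\<^sup>2 \<ge> 4" using power_mono[OF nW, of 2] by simp
  have ln2: "ln 2 \<le> (1 :: real)" using ln_le_minus_one[of 2] by simp
  have "ln (2 * real (M ^ n) ^ D) = ln 2 + real n * real D * ln (real M)"
    using M by (simp add: ln_mult ln_realpow power_mult[symmetric] del: power_mult)
  also have "\<dots> \<le> 1 + (real n * W)\<^sup>2 * ln (real M)"
  proof -
    have "real n * real D \<le> (real n * W)\<^sup>2"
      using mult_left_mono[OF D, of "real n"] by (simp add: power2_eq_square algebra_simps)
    then show ?thesis using ln2 lnM by (intro add_mono mult_right_mono) auto
  qed
  \<comment> \<open>The last \<open>+ 1\<close> stands for the discretization error in units of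
    \<open>1 / q\<^sup>2\<close>. All constants together stay below
    \<open>3 \<le> (n * W)\<^sup>2\<close>, which the summand 1 in \<open>m = 1 + ln M\<close>
    absorbs.\<close>
  finally have "ln (2 * real (M ^ n) ^ D) + 1 / 8 + 1 \<le> 3 + (real n * W)\<^sup>2 * ln (real M)" by simp
  also have "\<dots> \<le> (real n * W)\<^sup>2 + (real n * W)\<^sup>2 * ln (real M)" using nW2 by simp
  also have "\<dots> = (real n * W)\<^sup>2 * m" by (simp add: m_eq algebra_simps)
  finally have "2 * ((ln (2 * real (M ^ n) ^ D) + 1 / 8 + 1) / q\<^sup>2) \<le> 2 * ((real n * W)\<^sup>2 * m / q\<^sup>2)"
    by (intro mult_left_mono divide_right_mono) auto
  also have "\<dots> = (2 * 1) * ((real n * W)\<^sup>2 * m) / q\<^sup>2" by simp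
  also have "\<dots> \<le> (c ^ 6 * m) * ((real n * W)\<^sup>2 * m) / q\<^sup>2"
    using power_mono[of 2 c 6] c m1 by (intro divide_right_mono mult_right_mono mult_mono) auto
  also have "\<dots> = T\<^sup>2"
  proof -
    have "T\<^sup>2 = (c ^ 3 * (real n * W) * m / q)\<^sup>2" by (simp add: T_def m_def q_def mult.assoc)
    also have "\<dots> = (c ^ 3)\<^sup>2 * (real n * W)\<^sup>2 * m\<^sup>2 / q\<^sup>2" by (simp only: power_divide power_mult_distrib)
    also have "(c ^ 3)\<^sup>2 = c ^ 6" by simp
    finally show ?thesis by (simp add: power2_eq_square[of m])
  qed
  finally show ?thesis using second by (simp add: q2 add_divide_distrib)
qed

text \<open>\<open>\<tau>\<close> solves \<open>K * \<tau> ^ (D + 1) = 1\<close>, so the bound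
  \<open>1 / (K * \<tau> ^ D)\<close> for the failure probability equals \<open>\<tau>\<close>, in
  balance with the cost of the distance \<open>2 * c * \<tau>\<close>. The factor
  \<open>4 * n * p + 1\<close> in front of \<open>\<tau>\<close> disappears in
  \<open>(n * p * c)\<^sup>2\<close>.\<close>

lemma optimization_rate:
  fixes c W :: real and K n D :: nat
  assumes K: "K \<ge> 1" and c: "c \<ge> 2" and W: "W \<ge> 2" and n: "n \<ge> 1" and D: "real D + 1 \<le> real n * W\<^sup>2"
  defines "\<tau> \<equiv> real K powr (- 1 / (real D + 1))"
  shows "0 < \<tau>" "\<tau> \<le> 1" "(1 - \<tau> ^ D) ^ K \<le> \<tau>"
    "2 * (real n * (c * W) ^ n / c) * (2 * c * \<tau>) + \<tau>
      \<le> (real n * W ^ n * c ^ (n + 1) / real K powr (1 / (2 * real n * W\<^sup>2)))\<^sup>2"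
proof -
  show \<tau>0: "0 < \<tau>" using K by (simp add: \<tau>_def)
  have "\<tau> \<le> real K powr 0" unfolding \<tau>_def using K by (intro powr_mono) auto
  then show \<tau>1: "\<tau> \<le> 1" using K by simp
  have "\<tau> ^ (D + 1) = real K powr (- 1)"
  proof -
    have "\<tau> ^ (D + 1) = \<tau> powr real (D + 1)" by (rule powr_realpow[OF \<tau>0, symmetric])
    also have "\<dots> = real K powr (- 1 / (real D + 1) * real (D + 1))" by (simp only: \<tau>_def powr_powr)
    also have "- 1 / (real D + 1) * real (D + 1) = - 1" by (simp add: field_simps)
    finally show ?thesis .
  qed
  then have K\<tau>: "real K * (\<tau> ^ D * \<tau>) = 1"
    using K by (simp add: powr_minus_divide field_simps)
  have "(1 - \<tau> ^ D) ^ K \<le> 1 / (real K * \<tau> ^ D)"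
    using one_minus_power_le_inverse[of "\<tau> ^ D" K] \<tau>0 \<tau>1 K by (simp add: power_le_one)
  also have "\<dots> = \<tau>" using K\<tau> K \<tau>0 by (simp add: field_simps)
  finally show "(1 - \<tau> ^ D) ^ K \<le> \<tau>" .
  define p where "p = (c * W) ^ n"
  have n1: "real n \<ge> 1" using n by simp
  have "c * W \<ge> 4" using c W mult_mono[of 2 c 2 W] by simp
  then have p: "p \<ge> 4" unfolding p_def using self_le_power[of "c * W" n] n by simp
  have "\<tau> \<le> real K powr (- (1 / (real n * W\<^sup>2)))"
    unfolding \<tau>_def using K D by (intro powr_mono) (auto intro!: divide_left_mono)
  also have "\<dots> = 1 / (real K powr (1 / (2 * real n * W\<^sup>2)))\<^sup>2"
    using K by (simp add: powr_minus_divide power2_eq_square powr_add[symmetric] mult_ac)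
  finally have \<tau>_le: "\<tau> \<le> 1 / (real K powr (1 / (2 * real n * W\<^sup>2)))\<^sup>2" .
  have "2 * (real n * (c * W) ^ n / c) * (2 * c * \<tau>) + \<tau> = (4 * (real n * p) + 1) * \<tau>"
    using c by (simp add: p_def algebra_simps)
  also have "\<dots> \<le> (real n * p * c)\<^sup>2 * \<tau>"
  proof (rule mult_right_mono)
    have np: "real n * p \<ge> 4" using n1 p mult_mono[of 1 "real n" 4 p] by simp
    have "4 * (real n * p) + 1 \<le> 4 * (real n * p) * 4" using np by linarith
    also have "\<dots> \<le> (real n * p) * (real n * p) * c\<^sup>2"
      using np p power_mono[of 2 c 2] c by (intro mult_mono) auto
    also have "\<dots> = (real n * p * c)\<^sup>2" by (simp add: power2_eq_square)
    finally show "4 * (real n * p) + 1 \<le> (real n * p * c)\<^sup>2" .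
  qed (use \<tau>0 in simp)
  also have "\<dots> \<le> (real n * p * c)\<^sup>2 * (1 / (real K powr (1 / (2 * real n * W\<^sup>2)))\<^sup>2)"
    by (rule mult_left_mono[OF \<tau>_le]) simp
  also have "\<dots> = (real n * W ^ n * c ^ (n + 1) / real K powr (1 / (2 * real n * W\<^sup>2)))\<^sup>2"
    by (simp add: p_def power_divide power_mult_distrib algebra_simps)
  finally show "2 * (real n * (c * W) ^ n / c) * (2 * c * \<tau>) + \<tau>
      \<le> (real n * W ^ n * c ^ (n + 1) / real K powr (1 / (2 * real n * W\<^sup>2)))\<^sup>2" .
qed

section \<open>The overall error\<close>

text \<open>The 1 on the left is the one in the exponent \<open>1 / (D + 1)\<close>; it fits because
  \<open>w * (w + 1) + 1 \<le> (w + 1)\<^sup>2\<close>.\<close>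

lemma param_count_bound:
  assumes "\<And>i. i \<le> n \<Longrightarrow> l i \<le> w" "n \<ge> 1"
  shows "param_count l n + 1 \<le> n * (w + 1)\<^sup>2"
proof -
  have "param_count l n \<le> (\<Sum>k=1..n. w * (w + 1))"
    unfolding param_count_def using assms by (intro sum_mono mult_mono add_mono) auto
  also have "\<dots> + n \<le> n * (w + 1)\<^sup>2" by (simp add: power2_eq_square algebra_simps)
  finally show ?thesis using assms(2) by simp
qed

text \<open>The regression function is controlled on the cube alone, so it is extended by zero: a
  function continuous on a closed set becomes Borel on the whole space. As \<open>L\<close> may be
  negative, the Lipschitz constant is built from \<open>\<bar>L\<bar>\<close>.\<close>

lemma cube_lipschitz_measurable:
  fixes g :: "real ^ 'd::finite \<Rightarrow> real"
  assumes "\<forall>x\<in>unit_cube. \<forall>y\<in>unit_cube. \<bar>g x - g y\<bar> \<le> L * norm1 (x - y)"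
  shows "(\<lambda>x. indicator unit_cube x * g x) \<in> borel_measurable borel"
proof -
  have "norm1 z \<le> real CARD('d) * norm z" for z :: "real ^ 'd"
  proof -
    have "norm1 z \<le> (\<Sum>i\<in>(UNIV :: 'd set). norm z)"
      unfolding norm1_def by (intro sum_mono component_le_norm_cart)
    then show ?thesis by simp
  qed
  then have "L * norm1 z \<le> \<bar>L\<bar> * (real CARD('d) * norm z)" for z :: "real ^ 'd"
    by (intro mult_mono) (auto simp: norm1_def intro!: sum_nonneg)
  then have "(\<bar>L\<bar> * real CARD('d))-lipschitz_on unit_cube g"
    using assms by (intro lipschitz_onI) (auto simp: dist_norm mult.assoc intro: order_trans)
  then have "continuous_on unit_cube g" by (rule lipschitz_on_continuous_on)
  then show ?thesis
    using borel_measurable_continuous_on_indicator[of unit_cube g] by (simp add: unit_cube_def)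
qed

context clipped_relu_network
begin

definition realization :: "nat \<Rightarrow> (nat \<Rightarrow> 'p) \<Rightarrow> nat \<Rightarrow> (nat \<Rightarrow> 'd) \<Rightarrow> real ^ 'p \<Rightarrow> real ^ 'd \<Rightarrow> real" where
  "realization dd \<kappa> d \<iota> \<theta> x = network a l (to_tuple dd \<kappa> \<theta>) LL (to_tuple d \<iota> x) 1"

lemma realization_range: "realization dd \<kappa> d \<iota> \<theta> x \<in> {0..1}"
  unfolding realization_def by (rule network_output_range)

lemma realization_measurable:
  fixes \<kappa> :: "nat \<Rightarrow> 'p::finite" and \<iota> :: "nat \<Rightarrow> 'd::finite"
  shows "realization dd \<kappa> d \<iota> \<theta> \<in> borel_measurable borel"
proof -
  have "continuous_on UNIV (\<lambda>x :: real ^ 'd. to_tuple d \<iota> x k)" for k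
    unfolding to_tuple_def by (cases "k \<in> {1..d}") (auto intro!: continuous_intros)
  then have "continuous_on UNIV (\<lambda>x. network a l (to_tuple dd \<kappa> \<theta>) LL (to_tuple d \<iota> x) 1)"
    using l_LL by (intro continuous_network) auto
  then show ?thesis unfolding realization_def[abs_def] by (rule borel_measurable_continuous_onI)
qed

lemma realization_lipschitz:
  fixes \<kappa> :: "nat \<Rightarrow> 'p::finite" and \<iota> :: "nat \<Rightarrow> 'd::finite"
  assumes l0: "l 0 = d" and dd: "param_count l LL \<le> dd"
    and c: "c \<ge> 1" and W: "\<And>i. i \<le> LL \<Longrightarrow> real (l i) + 1 \<le> W"
    and \<theta>: "\<forall>i\<in>\<kappa> ` {1..param_count l LL}. \<theta> $ i \<in> {-c..c}"
    and \<eta>: "\<forall>i\<in>\<kappa> ` {1..param_count l LL}. \<eta> $ i \<in> {-c..c}"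
    and close: "\<forall>i\<in>\<kappa> ` {1..param_count l LL}. \<bar>\<theta> $ i - \<eta> $ i\<bar> \<le> \<epsilon>"
    and x: "x \<in> unit_cube"
  shows "\<bar>realization dd \<kappa> d \<iota> \<theta> x - realization dd \<kappa> d \<iota> \<eta> x\<bar> \<le> real LL * (c * W) ^ LL / c * \<epsilon>"
proof -
  have k: "k \<in> {1..dd}" "\<kappa> k \<in> \<kappa> ` {1..param_count l LL}" if "k \<in> {1..param_count l LL}" for k
    using that dd by auto
  have "c * \<bar>network a l (to_tuple dd \<kappa> \<theta>) LL (to_tuple d \<iota> x) 1
      - network a l (to_tuple dd \<kappa> \<eta>) LL (to_tuple d \<iota> x) 1\<bar> \<le> \<epsilon> * real LL * (c * W) ^ LL"
  proof (rule network_lipschitz)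
    show "\<And>i. i \<le> LL \<Longrightarrow> real (l i) + 1 \<le> W" by (rule W)
    fix k assume "k \<in> {1..param_count l LL}"
    note k = k[OF this]
    show "\<bar>to_tuple dd \<kappa> \<theta> k\<bar> \<le> c" using k bspec[OF \<theta> k(2)] by (auto simp: to_tuple_def)
    show "\<bar>to_tuple dd \<kappa> \<eta> k\<bar> \<le> c" using k bspec[OF \<eta> k(2)] by (auto simp: to_tuple_def)
    show "\<bar>to_tuple dd \<kappa> \<theta> k - to_tuple dd \<kappa> \<eta> k\<bar> \<le> \<epsilon>"
      using k bspec[OF close k(2)] by (simp add: to_tuple_def)
  next
    show "\<bar>to_tuple d \<iota> x j\<bar> \<le> 1" if "j \<in> {1..l 0}" for j
      using x that l0 by (simp add: mem_unit_cube to_tuple_def)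
  qed (use c l_LL in auto)
  then show ?thesis unfolding realization_def using c by (simp add: field_simps)
qed

end

theorem theorem1p1:
  fixes d dd LL JJ M K N :: nat
    and \<gamma> L c :: real
    and l :: "nat \<Rightarrow> nat"
    and NN :: "nat set"
    and \<iota> :: "nat \<Rightarrow> 'd::finite"
    and \<kappa> :: "nat \<Rightarrow> 'p::finite"
    and a :: "nat \<Rightarrow> (nat \<Rightarrow> real) \<Rightarrow> nat \<Rightarrow> real"
    and \<N> :: "real ^ 'p \<Rightarrow> real ^ 'd \<Rightarrow> real"
    and P :: "'w measure"
    and X :: "nat \<Rightarrow> nat \<Rightarrow> nat \<Rightarrow> 'w \<Rightarrow> real ^ 'd"
    and Y :: "nat \<Rightarrow> nat \<Rightarrow> nat \<Rightarrow> 'w \<Rightarrow> real"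
    and \<E> :: "real ^ 'd \<Rightarrow> real"
    and \<Theta> :: "nat \<Rightarrow> nat \<Rightarrow> 'w \<Rightarrow> real ^ 'p"
    and kk :: "'w \<Rightarrow> nat \<times> nat"
    and R :: "nat \<Rightarrow> nat \<Rightarrow> nat \<Rightarrow> real ^ 'p \<Rightarrow> 'w \<Rightarrow> real"
    and G :: "nat \<Rightarrow> nat \<Rightarrow> real ^ 'p \<Rightarrow> 'w \<Rightarrow> real ^ 'p"
  assumes "d \<ge> 1" "dd \<ge> 1" "LL \<ge> 1" "JJ \<ge> 1" "M \<ge> 1" "K \<ge> 1" "N \<ge> 1"
    and "bij_betw \<iota> {1..d} UNIV" "bij_betw \<kappa> {1..dd} UNIV"
    and "c \<ge> max 2 L"
    and "\<forall>i\<in>{0..LL}. l i \<ge> 1"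
    and "NN \<subseteq> {0..N}" "0 \<in> NN"
    and "l 0 = d" "l LL = 1"
    and "dd \<ge> (\<Sum>i=1..LL. l i * (l (i - 1) + 1))"
    and "\<forall>i\<in>{1..<LL}. \<forall>x\<in>tuples (l i). a i x = (\<lambda>j\<in>{1..l i}. max (x j) 0)"
    and "\<forall>x\<in>tuples 1. a LL x = (\<lambda>j\<in>{1..1}. max (min (x j) 1) 0)"
    and "\<forall>\<theta> x. \<N> \<theta> x = network a l (to_tuple dd \<kappa> \<theta>) LL (to_tuple d \<iota> x) 1"
    and "prob_space P"
    and "\<forall>k n j. X k n j \<in> space P \<rightarrow> unit_cube"
    and "\<forall>k n j. Y k n j \<in> space P \<rightarrow> {0..1}"
    and "iid P (\<lambda>j \<omega>. (X 0 0 j \<omega>, Y 0 0 j \<omega>)) {1..}"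
    and "\<E> \<in> unit_cube \<rightarrow> {0..1}"
    and "AE \<omega> in P. \<E> (X 0 0 1 \<omega>) = cond_exp_given P (Y 0 0 1) (X 0 0 1) \<omega>"
    and "\<forall>x\<in>unit_cube. \<forall>y\<in>unit_cube. \<bar>\<E> x - \<E> y\<bar> \<le> L * norm1 (x - y)"
    and "\<forall>k n. \<Theta> k n \<in> borel_measurable P"
    and "kk \<in> measurable P (count_space UNIV)"
    and "(\<Union>k\<in>{1..}. \<Theta> k 0 ` space P) \<subseteq> cbox (\<chi> i. -c) (\<chi> i. c)"
    and "iid P (\<lambda>k. \<Theta> k 0) {1..}"
    and "distr P borel (\<Theta> 1 0) = uniform_measure lborel (cbox (\<chi> i. -c) (\<chi> i. c))"
    and "\<forall>k n J \<theta>. \<forall>\<omega>\<in>space P. R k n J \<theta> \<omega> \<ge> 0"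
    and "\<forall>k\<ge>1. \<forall>n\<ge>1. \<forall>\<omega>\<in>space P. \<forall>\<theta>.
           (\<lambda>\<theta>. R k n JJ \<theta> \<omega>) differentiable (at \<theta>) \<longrightarrow>
           GDERIV (\<lambda>\<theta>. R k n JJ \<theta> \<omega>) \<theta> :> G k n \<theta> \<omega>"
    and "\<forall>k\<ge>1. \<forall>n\<ge>1. \<forall>\<omega>\<in>space P.
           \<Theta> k n \<omega> = \<Theta> k (n - 1) \<omega> - \<gamma> *\<^sub>R G k n (\<Theta> k (n - 1) \<omega>) \<omega>"
    and "\<forall>k n. \<forall>J\<ge>1. \<forall>\<theta>. \<forall>\<omega>\<in>space P.
           R k n J \<theta> \<omega> = 1 / real J * (\<Sum>j=1..J. \<bar>\<N> \<theta> (X k n j \<omega>) - Y k n j \<omega>\<bar>\<^sup>2)"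
    and "\<forall>\<omega>\<in>space P.
           is_arg_min (\<lambda>(k, n). R 0 0 M (\<Theta> k n \<omega>) \<omega>)
             (\<lambda>(k, n). (k, n) \<in> {1..K} \<times> NN \<and> infnorm (\<Theta> k n \<omega>) \<le> c) (kk \<omega>)"
  shows "(LINT \<omega>|P. (LINT x:unit_cube|distr P borel (X 0 0 1).
             \<bar>\<N> (case kk \<omega> of (k, n) \<Rightarrow> \<Theta> k n \<omega>) x - \<E> x\<bar>))
         \<le> real d * c ^ 3 / real (Min ({LL} \<union> l ` {1..<LL})) powr (1 / real d)
           + c ^ 3 * real LL * (real (Max (l ` {0..LL})) + 1) * ln (exp 1 * real M) / real M powr (1 / 4)
           + real LL * (real (Max (l ` {0..LL})) + 1) ^ LL * c ^ (LL + 1)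
             / real K powr (1 / (2 * real LL * (real (Max (l ` {0..LL})) + 1)\<^sup>2))"
proof -
  note c = assms(10) and X_cube = assms(21)[rule_format] and Y_range = assms(22)[rule_format]
  note R_eq = assms(35)[rule_format] and arg_min = assms(36)[rule_format]
  interpret prob_space P by (rule assms(20))
  interpret net: clipped_relu_network LL l a
    using assms(3,11,15,17,18) by unfold_locales auto
  define w where "w = Max (l ` {0..LL})"
  define W where "W = real w + 1"
  define D where "D = param_count l LL"
  \<comment> \<open>The coordinates that the network reads; counting these \<open>D\<close> instead
    of all \<open>dd\<close> keeps \<open>dd\<close> out of the rates.\<close>
  define A where "A = \<kappa> ` {1..D}"
  define f where "f = net.realization dd \<kappa> d \<iota>"
  define B where "B = real LL * (c * W) ^ LL / c"
  \<comment> \<open>\<open>\<E>\<close> is arbitrary outside the cube; \<open>e\<close> agrees with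
    it where \<open>X\<close> lives and is Borel with values in \<open>[0, 1]\<close>
    everywhere.\<close>
  define e where "e x = indicator unit_cube x * \<E> x" for x
  define T1 where "T1 = real d * c ^ 3 / real (Min ({LL} \<union> l ` {1..<LL})) powr (1 / real d)"
  define T2 where "T2 = c ^ 3 * real LL * W * ln (exp 1 * real M) / real M powr (1 / 4)"
  define T3 where "T3 = real LL * W ^ LL * c ^ (LL + 1) / real K powr (1 / (2 * real LL * W\<^sup>2))"
  define I where "I \<omega> = (LINT x:unit_cube|distr P borel (X 0 0 1).
    \<bar>\<N> (case kk \<omega> of (k, n) \<Rightarrow> \<Theta> k n \<omega>) x - \<E> x\<bar>)" for \<omega>
  have N: "\<N> \<theta> x = f \<theta> x" for \<theta> x
    using assms(19) by (simp add: f_def net.realization_def)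
  have c2: "c \<ge> 2" using c by simp
  have lw: "l i \<le> w" if "i \<le> LL" for i using that by (auto simp: w_def intro!: Max_ge)
  have W_l: "real (l i) + 1 \<le> W" if "i \<le> LL" for i using lw[OF that] by (simp add: W_def)
  have W2: "W \<ge> 2" using lw[of 0] assms(1,14) by (simp add: W_def)
  have D: "D + 1 \<le> LL * (w + 1)\<^sup>2" unfolding D_def using lw assms(3) by (intro param_count_bound) auto
  have "real (D + 1) \<le> real (LL * (w + 1)\<^sup>2)" using D by (simp only: of_nat_le_iff)
  then have D': "real D + 1 \<le> real LL * W\<^sup>2" by (simp add: W_def add.commute)
  have D_le: "D \<le> dd" using assms(16) by (simp add: D_def param_count_def)
  have card_A: "card A = D"
  proof -
    have "inj_on \<kappa> {1..D}"
      using D_le by (intro inj_on_subset[OF bij_betw_imp_inj_on[OF assms(9)]]) auto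
    then show ?thesis by (simp add: A_def card_image)
  qed
  have T_nonneg: "0 \<le> T1" "0 \<le> T2" "0 \<le> T3"
    using c2 W2 assms(5) by (auto simp: T1_def T2_def T3_def ln_mult)
  have f_range: "f \<theta> x \<in> {0..1}" for \<theta> x unfolding f_def by (rule net.realization_range)
  have f_meas: "f \<theta> \<in> borel_measurable borel" for \<theta> unfolding f_def by (rule net.realization_measurable)
  have f_lip: "\<bar>f \<theta> x - f \<eta> x\<bar> \<le> B * \<epsilon>"
    if "\<forall>i\<in>A. \<theta> $ i \<in> {-c..c}" "\<forall>i\<in>A. \<eta> $ i \<in> {-c..c}" "\<forall>i\<in>A. \<bar>\<theta> $ i - \<eta> $ i\<bar> \<le> \<epsilon>"
      "x \<in> unit_cube" for \<theta> \<eta> x \<epsilon>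
    unfolding f_def B_def
    by (rule net.realization_lipschitz) (use that assms(14) D_le c2 W_l in \<open>auto simp: A_def D_def\<close>)
  have e_meas: "e \<in> borel_measurable borel"
    unfolding e_def[abs_def] by (rule cube_lipschitz_measurable[OF assms(26)])
  have e_range: "e x \<in> {0..1}" for x
    using assms(24) by (auto simp: e_def indicator_def)
  have Z: "random_variable borel (\<lambda>\<omega>. (X 0 0 1 \<omega>, Y 0 0 1 \<omega>))"
    using assms(23) by (auto simp: iid_def indep_vars_def)
  have X_meas: "random_variable borel (X 0 0 1)"
    using measurable_compose[OF Z borel_measurable_continuous_onI[OF continuous_on_fst[OF continuous_on_id]]]
    by simp
  have Y_meas: "random_variable borel (Y 0 0 1)"
    using measurable_compose[OF Z borel_measurable_continuous_onI[OF continuous_on_snd[OF continuous_on_id]]]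
    by simp
  have X1: "X 0 0 j \<omega> \<in> unit_cube" and Y1: "Y 0 0 j \<omega> \<in> {0..1}" if "\<omega> \<in> space P" for j \<omega>
    using X_cube[of 0 0 j] Y_range[of 0 0 j] that by auto

  define excess where "excess \<theta> = expectation (\<lambda>\<omega>. (f \<theta> (X 0 0 1 \<omega>) - e (X 0 0 1 \<omega>))\<^sup>2)" for \<theta>
  define loss where "loss \<theta> = (\<lambda>(x, y). (f \<theta> x - y)\<^sup>2)" for \<theta>
  define risk where "risk \<theta> = expectation (\<lambda>\<omega>. loss \<theta> (X 0 0 1 \<omega>, Y 0 0 1 \<omega>))" for \<theta>
  define emp where "emp \<theta> \<omega> = (\<Sum>j=1..M. loss \<theta> (X 0 0 j \<omega>, Y 0 0 j \<omega>)) / real M" for \<theta> \<omega>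
  \<comment> \<open>The irreducible noise: independent of the parameter, it cancels when two risks
    are compared.\<close>
  define \<rho> where "\<rho> = expectation (\<lambda>\<omega>. (e (X 0 0 1 \<omega>) - Y 0 0 1 \<omega>)\<^sup>2)"
  have R_emp: "R 0 0 M \<theta> \<omega> = emp \<theta> \<omega>" if "\<omega> \<in> space P" for \<theta> \<omega>
    using R_eq[OF assms(5) that, of 0 0 \<theta>] by (simp add: emp_def loss_def N)
  have risk_eq: "risk \<theta> = excess \<theta> + \<rho>" for \<theta>
    unfolding risk_def loss_def excess_def \<rho>_def prod.case
  proof (rule excess_risk[OF X_meas Y_meas Y1 f_meas f_range e_meas e_range])
    show "AE \<omega> in P. e (X 0 0 1 \<omega>) = cond_exp_given P (Y 0 0 1) (X 0 0 1) \<omega>"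
      using assms(25) by (rule AE_mp) (auto intro!: AE_I2 simp: e_def X1)
  qed
  have diff_le: "\<bar>f \<theta> x - e x\<bar> \<le> 1" for \<theta> x using f_range[of \<theta> x] e_range[of x] by auto
  have diff_meas: "random_variable borel (\<lambda>\<omega>. f \<theta> (X 0 0 1 \<omega>) - e (X 0 0 1 \<omega>))" for \<theta>
    using measurable_compose[OF X_meas f_meas] measurable_compose[OF X_meas e_meas] by simp
  have diff_int: "integrable P (\<lambda>\<omega>. \<bar>f \<theta> (X 0 0 1 \<omega>) - e (X 0 0 1 \<omega>)\<bar>)"
    "integrable P (\<lambda>\<omega>. (f \<theta> (X 0 0 1 \<omega>) - e (X 0 0 1 \<omega>))\<^sup>2)" for \<theta>
    using diff_meas[of \<theta>] diff_le
    by (intro integrable_const_bound[of _ 1] AE_I2; simp add: abs_square_le_1)+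
  \<comment> \<open>The outer \<open>\<omega>\<close> only selects \<open>\<theta>\<close>. The
    integral over the law of \<open>X 0 0 1\<close> becomes an expectation in a fresh variable
    \<open>\<omega>'\<close>, so \<open>I\<close> is a deterministic function of the selected
    parameter.\<close>
  have I_eq: "I \<omega> = expectation (\<lambda>\<omega>'. \<bar>f \<theta> (X 0 0 1 \<omega>') - e (X 0 0 1 \<omega>')\<bar>)"
    if "\<theta> = (case kk \<omega> of (k, n) \<Rightarrow> \<Theta> k n \<omega>)" for \<theta> \<omega>
  proof -
    have g: "(\<lambda>x. indicator unit_cube x *\<^sub>R \<bar>f \<theta> x - \<E> x\<bar>) = (\<lambda>x. indicator unit_cube x *\<^sub>R \<bar>f \<theta> x - e x\<bar>)"
      by (auto simp: e_def indicator_def)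
    have cube: "unit_cube \<in> sets borel" by (simp add: unit_cube_def)
    have "I \<omega> = (LINT x|distr P borel (X 0 0 1). indicator unit_cube x *\<^sub>R \<bar>f \<theta> x - e x\<bar>)"
      unfolding I_def that[symmetric] set_lebesgue_integral_def N g ..
    also have "\<dots> = expectation (\<lambda>\<omega>'. indicator unit_cube (X 0 0 1 \<omega>') *\<^sub>R \<bar>f \<theta> (X 0 0 1 \<omega>') - e (X 0 0 1 \<omega>')\<bar>)"
      by (intro integral_distr[OF X_meas] borel_measurable_scaleR borel_measurable_indicator
        borel_measurable_abs borel_measurable_diff cube f_meas e_meas)
    also have "\<dots> = expectation (\<lambda>\<omega>'. \<bar>f \<theta> (X 0 0 1 \<omega>') - e (X 0 0 1 \<omega>')\<bar>)"
      by (intro Bochner_Integration.integral_cong) (auto simp: X1)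
    finally show ?thesis .
  qed
  have I_range: "\<bar>I \<omega>\<bar> \<le> 1" for \<omega>
  proof -
    define \<theta> where "\<theta> = (case kk \<omega> of (k, n) \<Rightarrow> \<Theta> k n \<omega>)"
    have "I \<omega> \<le> expectation (\<lambda>\<omega>'. 1)"
      unfolding I_eq[OF \<theta>_def] using diff_int(1) diff_le by (intro integral_mono) auto
    moreover have "I \<omega> \<ge> 0" unfolding I_eq[OF \<theta>_def] by (intro integral_nonneg_AE) auto
    ultimately show ?thesis by (simp add: prob_space)
  qed
  have I_square: "(I \<omega>)\<^sup>2 \<le> excess (case kk \<omega> of (k, n) \<Rightarrow> \<Theta> k n \<omega>)" for \<omega>
    using expectation_square_le[OF diff_int(1)] diff_int(2)
    by (simp add: I_eq[OF refl] excess_def)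

  have "expectation I \<le> T1 + T2 + T3"
  \<comment> \<open>If \<open>I\<close> is not integrable, its Bochner integral is 0 by convention,
    below the nonnegative bound.\<close>
  proof (cases "integrable P I")
    case False
    then show ?thesis using T_nonneg by (simp add: not_integrable_integral_eq)
  next
    case int_I: True
    show ?thesis
    proof (cases "T1 < 1 \<and> T2 < 1")
      case False
      have "expectation I \<le> expectation (\<lambda>_. 1)"
        using int_I I_range by (intro integral_mono) (auto simp: abs_le_iff)
      then show ?thesis using False T_nonneg by (auto simp: prob_space)
    next
      case True
      define \<tau> where "\<tau> = real K powr (- 1 / (real D + 1))"
      note opt = optimization_rate[OF assms(6) c2 W2 assms(3) D', folded \<tau>_def]

      obtain \<phi> where \<phi>: "\<And>q. \<bar>\<phi> q\<bar> \<le> c" "\<And>x. x \<in> unit_cube \<Longrightarrow>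
          \<bar>network a l \<phi> LL (to_tuple d \<iota> x) 1 - \<E> x\<bar> \<le> T1"
        using net.network_approximation[OF assms(1,8,14) c assms(24) assms(26)[rule_format]] True
        unfolding T1_def by blast
      \<comment> \<open>\<open>\<phi>\<close> is indexed by position; inverting
        \<open>\<kappa>\<close> puts its values at the matching coordinates.\<close>
      define \<theta>0 :: "real ^ 'p" where "\<theta>0 = (\<chi> i. \<phi> (inv_into {1..dd} \<kappa> i))"
      have \<theta>0: "\<forall>i. \<theta>0 $ i \<in> {-c..c}" using \<phi>(1) by (auto simp: \<theta>0_def abs_le_iff minus_le_iff)
      have f\<theta>0: "\<bar>f \<theta>0 x - e x\<bar> \<le> T1" if x: "x \<in> unit_cube" for x
      proof -
        have k: "to_tuple dd \<kappa> \<theta>0 k = \<phi> k" if "k \<in> {1..D}" for k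
          using that D_le bij_betw_imp_inj_on[OF assms(9)] by (simp add: to_tuple_def \<theta>0_def inv_into_f_f)
        \<comment> \<open>The Lipschitz bound with \<open>\<epsilon> = 0\<close> says that the
          output depends only on the first \<open>D\<close> parameter positions.\<close>
        have "c * \<bar>network a l (to_tuple dd \<kappa> \<theta>0) LL (to_tuple d \<iota> x) 1
            - network a l \<phi> LL (to_tuple d \<iota> x) 1\<bar> \<le> 0 * real LL * (c * W) ^ LL"
        proof (rule net.network_lipschitz)
          show "\<And>i. i \<le> LL \<Longrightarrow> real (l i) + 1 \<le> W" by (rule W_l)
          show "\<bar>to_tuple d \<iota> x j\<bar> \<le> 1" if "j \<in> {1..l 0}" for j
            using x that assms(14) by (simp add: mem_unit_cube to_tuple_def)
        qed (use c2 \<phi>(1) k assms(15) in \<open>auto simp: D_def\<close>)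
        then have "f \<theta>0 x = network a l \<phi> LL (to_tuple d \<iota> x) 1"
          using c2 by (simp add: f_def net.realization_def mult_le_0_iff)
        then show ?thesis using \<phi>(2)[OF x] x by (simp add: e_def)
      qed
      have excess0: "excess \<theta>0 \<le> T1\<^sup>2"
      proof -
        have "excess \<theta>0 \<le> expectation (\<lambda>_. T1\<^sup>2)"
          unfolding excess_def using diff_int(2) f\<theta>0 X1
          by (intro integral_mono) (auto simp: abs_le_square_iff[symmetric] T_nonneg)
        then show ?thesis by (simp add: prob_space)
      qed

      have loss_range: "loss \<theta> (X 0 0 j \<omega>, Y 0 0 j \<omega>) \<in> {0..1}" if "\<omega> \<in> space P" for \<theta> j \<omega>
        using f_range[of \<theta> "X 0 0 j \<omega>"] Y1[OF that, of j] by (auto simp: loss_def abs_square_le_1)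
      have loss_lip: "\<bar>loss \<theta> (X 0 0 j \<omega>, Y 0 0 j \<omega>) - loss \<eta> (X 0 0 j \<omega>, Y 0 0 j \<omega>)\<bar> \<le> (2 * B) * \<epsilon>"
        if "\<forall>i\<in>A. \<theta> $ i \<in> {-c..c}" "\<forall>i\<in>A. \<eta> $ i \<in> {-c..c}" "\<forall>i\<in>A. \<bar>\<theta> $ i - \<eta> $ i\<bar> \<le> \<epsilon>"
          "\<omega> \<in> space P" for \<theta> \<eta> j \<omega> \<epsilon>
      proof -
        let ?x = "X 0 0 j \<omega>" and ?y = "Y 0 0 j \<omega>"
        have "\<bar>(f \<theta> ?x - ?y)\<^sup>2 - (f \<eta> ?x - ?y)\<^sup>2\<bar> \<le> 2 * \<bar>f \<theta> ?x - f \<eta> ?x\<bar>"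
          by (rule square_loss_lipschitz[OF f_range f_range Y1[OF that(4)]])
        also have "\<dots> \<le> 2 * (B * \<epsilon>)" using f_lip[OF that(1-3) X1[OF that(4)]] by simp
        finally show ?thesis by (simp add: loss_def)
      qed
      have loss_meas: "loss \<theta> \<in> borel_measurable borel" for \<theta>
      proof -
        have "(\<lambda>z. (f \<theta> (fst z) - snd z)\<^sup>2) \<in> borel_measurable (borel \<Otimes>\<^sub>M borel)"
          using f_meas[of \<theta>] by measurable
        then show ?thesis by (simp add: loss_def[abs_def] borel_prod case_prod_beta')
      qed
      obtain S where S: "integrable P S"
        "expectation S \<le> (ln (2 * real (M ^ LL) ^ D) + 1 / 8) / sqrt (real M) + 2 * (2 * B * (c / real (M ^ LL)))"
        "\<And>\<theta> \<omega>. \<forall>i\<in>A. \<theta> $ i \<in> {-c..c} \<Longrightarrow> \<omega> \<in> space P \<Longrightarrow> \<bar>emp \<theta> \<omega> - risk \<theta>\<bar> \<le> S \<omega>"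
      proof -
        have "\<exists>S. integrable P S \<and> expectation S \<le> (ln (2 * real (M ^ LL) ^ card A) + 1 / 8) / sqrt (real M)
            + 2 * (2 * B * (c / real (M ^ LL))) \<and>
          (\<forall>\<theta>. (\<forall>i\<in>A. \<theta> $ i \<in> {-c..c}) \<longrightarrow> (\<forall>\<omega>\<in>space P. \<bar>emp \<theta> \<omega> - risk \<theta>\<bar> \<le> S \<omega>))"
          unfolding emp_def risk_def
        proof (rule uniform_deviation_lipschitz[OF assms(23)])
          show "loss \<theta> \<in> borel_measurable borel" for \<theta> by (rule loss_meas)
          show "loss \<theta> (X 0 0 j \<omega>, Y 0 0 j \<omega>) \<in> {0..1}" if "\<omega> \<in> space P" for \<theta> j \<omega>
            by (rule loss_range[OF that])
          show "\<bar>loss \<theta> (X 0 0 j \<omega>, Y 0 0 j \<omega>) - loss \<eta> (X 0 0 j \<omega>, Y 0 0 j \<omega>)\<bar> \<le> 2 * B * \<epsilon>"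
            if "\<forall>i\<in>A. \<theta> $ i \<in> {-c..c}" "\<forall>i\<in>A. \<eta> $ i \<in> {-c..c}"
              "\<forall>i\<in>A. \<bar>\<theta> $ i - \<eta> $ i\<bar> \<le> \<epsilon>" "\<omega> \<in> space P" for \<theta> \<eta> j \<omega> \<epsilon>
            by (rule loss_lip[OF that])
        qed (use c2 assms(5) in auto)
        then show ?thesis using that unfolding card_A by blast
      qed
      have S_le: "2 * expectation S \<le> T2\<^sup>2"
      proof -
        have "2 * expectation S \<le> 2 * ((ln (2 * real (M ^ LL) ^ D) + 1 / 8) / sqrt (real M)
            + 2 * (2 * B * (c / real (M ^ LL))))" by (rule mult_left_mono[OF S(2)]) simp
        also have "\<dots> \<le> T2\<^sup>2"
          unfolding T2_def B_def using True D' by (intro generalization_rate assms c2 W2) (auto simp: T2_def)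
        finally show ?thesis .
      qed

      define far where "far = {\<omega> \<in> space P. \<forall>k\<in>{1..K}. \<not> (\<forall>i\<in>A. \<bar>\<Theta> k 0 \<omega> $ i - \<theta>0 $ i\<bar> \<le> 2 * c * \<tau>)}"
      have far: "far \<in> events" "prob far \<le> \<tau>"
      proof -
        have "c > 0" using c2 by simp
        note all_far = prob_all_far[OF assms(30,31) this, of A \<theta>0 \<tau> K, folded far_def]
        show "far \<in> events" using \<theta>0 opt(1,2) assms(6) by (intro all_far) auto
        have "prob far \<le> (1 - \<tau> ^ card A) ^ K" using \<theta>0 opt(1,2) assms(6) by (intro all_far) auto
        then show "prob far \<le> \<tau>" using opt(3) card_A by simp
      qed
      have emp_close: "\<bar>emp \<theta> \<omega> - emp \<eta> \<omega>\<bar> \<le> \<delta>"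
        if "\<And>j. \<bar>loss \<theta> (X 0 0 j \<omega>, Y 0 0 j \<omega>) - loss \<eta> (X 0 0 j \<omega>, Y 0 0 j \<omega>)\<bar> \<le> \<delta>" for \<theta> \<eta> \<omega> \<delta>
      proof -
        have "\<bar>(\<Sum>j=1..M. loss \<theta> (X 0 0 j \<omega>, Y 0 0 j \<omega>)) - (\<Sum>j=1..M. loss \<eta> (X 0 0 j \<omega>, Y 0 0 j \<omega>))\<bar>
            \<le> (\<Sum>j=1..M. \<delta>)"
          unfolding sum_subtractf[symmetric] using that by (intro order_trans[OF sum_abs] sum_mono) auto
        then have "\<bar>(\<Sum>j=1..M. loss \<theta> (X 0 0 j \<omega>, Y 0 0 j \<omega>)) - (\<Sum>j=1..M. loss \<eta> (X 0 0 j \<omega>, Y 0 0 j \<omega>))\<bar>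
            / real M \<le> \<delta>"
          using assms(5) by (simp add: divide_le_eq mult.commute)
        then show ?thesis using assms(5) by (simp add: emp_def diff_divide_distrib[symmetric])
      qed
      \<comment> \<open>The summands: approximation by \<open>\<theta>0\<close>; one
        \<open>S\<close> each for passing between risk and empirical risk at the selected parameter
        and at \<open>\<theta>0\<close>; the change of the empirical risk over the distance
        \<open>2 * c * \<tau>\<close>; and, if all initializations are far, the trivial bound 1 for
        a difference of losses in \<open>[0, 1]\<close>.\<close>
      define U where "U \<omega> = T1\<^sup>2 + 2 * S \<omega> + 2 * B * (2 * c * \<tau>) + indicator far \<omega>" for \<omega>
      have B0: "B \<ge> 0" using c2 W2 by (simp add: B_def)
      have I_le: "(I \<omega>)\<^sup>2 \<le> U \<omega>" if \<omega>: "\<omega> \<in> space P" for \<omega>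
      proof -
        obtain k n where kn: "kk \<omega> = (k, n)" by (cases "kk \<omega>")
        have am: "(k, n) \<in> {1..K} \<times> NN" "infnorm (\<Theta> k n \<omega>) \<le> c"
          "\<And>k' n'. (k', n') \<in> {1..K} \<times> NN \<Longrightarrow> infnorm (\<Theta> k' n' \<omega>) \<le> c \<Longrightarrow>
             emp (\<Theta> k n \<omega>) \<omega> \<le> emp (\<Theta> k' n' \<omega>) \<omega>"
          using arg_min[OF \<omega>] unfolding kn is_arg_min_def by (auto simp: R_emp[OF \<omega>] not_less)
        \<comment> \<open>The norm constraint in the selection keeps the chosen iterate in the cube
          where \<open>S\<close> applies, wherever the gradient steps may lead.\<close>
        have box: "\<forall>i\<in>A. \<Theta> k n \<omega> $ i \<in> {-c..c}"

        proof
          fix i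
          have "\<bar>\<Theta> k n \<omega> $ i\<bar> \<le> c" using am(2) component_le_infnorm_cart order_trans by blast
          then show "\<Theta> k n \<omega> $ i \<in> {-c..c}" by auto
        qed
        have init: "\<forall>i. \<Theta> k' 0 \<omega> $ i \<in> {-c..c}" "emp (\<Theta> k n \<omega>) \<omega> \<le> emp (\<Theta> k' 0 \<omega>) \<omega>"
          if k': "k' \<in> {1..K}" for k'
        proof -
          have "\<Theta> k' 0 \<omega> \<in> cbox (\<chi> i. -c) (\<chi> i. c)" using assms(29) \<omega> k' by auto
          then show *: "\<forall>i. \<Theta> k' 0 \<omega> $ i \<in> {-c..c}" by (simp add: mem_box_cart)
          have "infnorm (\<Theta> k' 0 \<omega>) \<le> c"
            unfolding infnorm_cart using * by (intro cSup_least) (auto simp: abs_le_iff minus_le_iff)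
          then show "emp (\<Theta> k n \<omega>) \<omega> \<le> emp (\<Theta> k' 0 \<omega>) \<omega>" using am(3) k' assms(13) by auto
        qed
        have "emp (\<Theta> k n \<omega>) \<omega> \<le> emp \<theta>0 \<omega> + 2 * B * (2 * c * \<tau>) + indicator far \<omega>"
        proof (cases "\<omega> \<in> far")
          case True
          have K1: "1 \<in> {1..K}" using assms(6) by simp
          have "\<bar>emp (\<Theta> 1 0 \<omega>) \<omega> - emp \<theta>0 \<omega>\<bar> \<le> 1"
          proof (rule emp_close)
            fix j
            show "\<bar>loss (\<Theta> 1 0 \<omega>) (X 0 0 j \<omega>, Y 0 0 j \<omega>) - loss \<theta>0 (X 0 0 j \<omega>, Y 0 0 j \<omega>)\<bar> \<le> 1"
              using loss_range[OF \<omega>, of "\<Theta> 1 0 \<omega>" j] loss_range[OF \<omega>, of \<theta>0 j] by auto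
          qed
          moreover have "0 \<le> 2 * B * (2 * c * \<tau>)" using B0 c2 opt(1) by simp
          moreover have "indicator far \<omega> = (1 :: real)" using True by simp
          ultimately show ?thesis using init(2)[OF K1] by linarith
        next
          case False
          then obtain k' where k': "k' \<in> {1..K}" "\<forall>i\<in>A. \<bar>\<Theta> k' 0 \<omega> $ i - \<theta>0 $ i\<bar> \<le> 2 * c * \<tau>"
            using \<omega> by (auto simp: far_def)
          have "\<bar>emp (\<Theta> k' 0 \<omega>) \<omega> - emp \<theta>0 \<omega>\<bar> \<le> 2 * B * (2 * c * \<tau>)"
            using init(1)[OF k'(1)] \<theta>0 k'(2) \<omega> by (intro emp_close loss_lip) auto
          moreover have "indicator far \<omega> = (0 :: real)" using False by simp
          ultimately show ?thesis using init(2)[OF k'(1)] by linarith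
        qed
        moreover have "\<bar>emp (\<Theta> k n \<omega>) \<omega> - risk (\<Theta> k n \<omega>)\<bar> \<le> S \<omega>" by (rule S(3)[OF box \<omega>])
        moreover have "\<bar>emp \<theta>0 \<omega> - risk \<theta>0\<bar> \<le> S \<omega>" using \<theta>0 by (intro S(3)[OF _ \<omega>]) auto
        ultimately have "excess (\<Theta> k n \<omega>) \<le> U \<omega>"
          using excess0 risk_eq[of "\<Theta> k n \<omega>"] risk_eq[of \<theta>0] unfolding U_def by linarith
        then show ?thesis using I_square[of \<omega>] kn by simp
      qed
      have int_I2: "integrable P (\<lambda>\<omega>. (I \<omega>)\<^sup>2)"
        using borel_measurable_integrable[OF int_I] I_range
        by (intro integrable_const_bound[of _ 1] AE_I2) (auto simp: abs_square_le_1)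
      have int_far: "integrable P (indicator far :: _ \<Rightarrow> real)"
        using far(1) by (simp add: integrable_indicator_iff less_top[symmetric])
      have int_U: "integrable P U" unfolding U_def[abs_def] using S(1) int_far by simp
      have "(expectation I)\<^sup>2 \<le> expectation (\<lambda>\<omega>. (I \<omega>)\<^sup>2)"
        by (rule expectation_square_le[OF int_I int_I2])
      also have "\<dots> \<le> expectation U" by (rule integral_mono[OF int_I2 int_U I_le])
      also have "\<dots> = T1\<^sup>2 + 2 * expectation S + 2 * B * (2 * c * \<tau>) + prob far"
        unfolding U_def[abs_def] using S(1) int_far far(1) by (simp add: prob_space)
      also have "\<dots> \<le> T1\<^sup>2 + T2\<^sup>2 + T3\<^sup>2"
        using S_le far(2) opt(4) unfolding T3_def B_def by linarith
      also have "\<dots> \<le> (T1 + T2 + T3)\<^sup>2"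
        using T_nonneg by (simp add: power2_eq_square algebra_simps)
      finally have "(expectation I)\<^sup>2 \<le> (T1 + T2 + T3)\<^sup>2" .
      then show ?thesis by (rule power2_le_imp_le) (use T_nonneg in simp)
    qed
  qed
  then show ?thesis
    unfolding I_def[abs_def] T1_def T2_def T3_def W_def w_def by simp
qed

end
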